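(* The diversity $(\mathbb{U},\delta_{\mathbb{U}})$ (constructed in the context) is ultrahomogeneous: for any two finite subsets $A,A'\subseteq\mathbb{U}$ and any isomorphism $\phi:A\to A'$ (for the restricted diversities), there is an isomorphism of $(\mathbb{U},\delta_{\mathbb{U}})$ onto itself that extends $\phi$.
   Context: Write $\mathcal{P}_{\mathrm{fin}}(X)$ for the set of finite subsets of $X$. A diversity is a pair $(X,\delta)$ with $X$ a set and $\delta:\mathcal{P}_{\mathrm{fin}}(X)\to\mathbb{R}$ such that for all finite $A,B,C\subseteq X$: (D1) $\delta(A)\ge 0$, and $\delta(A)=0$ if and only if $|A|\le 1$; (D2) if $B\ne\emptyset$ then $\delta(A\cup B)+\delta(B\cup C)\ge\delta(A\cup C)$. The induced metric is $d(a,b)=\delta(\{a,b\})$. A subset of $X$ is a diversity under the restriction of $\delta$. An isomorphism from $(X,\delta_X)$ onto $(Y,\delta_Y)$ is a bijection $\phi$ with $\delta_Y(\phi(A))=\delta_X(A)$ for all finite $A\subseteq X$. Admissible functions: $f:\mathcal{P}_{\mathrm{fin}}(X)\to\mathbb{R}$ is admissible on $(X,\delta)$ if for some point $z$ (possibly in $X$) there is a diversity $(X\cup\{z\},\delta')$ with $\delta'(A)=\delta(A)$ and $\delta'(A\cup\{z\})=f(A)$ for all finite $A\subseteq X$. $E(X)$ is the set of admissible functions on $(X,\delta)$. It carries the diversity $\widehat\delta$ with $\widehat\delta(\emptyset)=\widehat\delta(\{f\})=0$ and, for distinct $f_1,\dots,f_k$, $k\ge 2$, $$\widehat\delta(\{f_1,\ldots,f_k\})=\max_{1\le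 j\le k}\ \sup_{A_1,\ldots,A_k}\Big\{f_j\big(\bigcup_{i\ne j}A_i\big)-\sum_{i\ne j}f_i(A_i)\Big\},$$ the $A_i$ ranging over finite subsets of $X$. $(X,\delta)$ embeds in $(E(X),\widehat\delta)$ via $x\mapsto\kappa_x$, $\kappa_x(A)=\delta(A\cup\{x\})$. Finite support: for nonempty $S\subseteq X$ and $f\in E(S)$ ($S$ with the restricted diversity), let $$f_S^X(A)=\inf\Big\{f(B)+\sum_{b\in B}\delta(A_b\cup\{b\}) : B\subseteq S\text{ finite},\ \bigcup_{b\in B}A_b=A\Big\}$$ for finite $A\subseteq X$. A function $g\in E(X)$ is finitely supported if $g=f_S^X$ for some finite nonempty $S\subseteq X$ and $f\in E(S)$. $E(X,\omega)$ is the set of finitely supported elements of $E(X)$, with the diversity $\widehat\delta$; it contains all $\kappa_x$. Construction: given $(X,\delta)$, put $(X_0,\delta_0)=(X,\delta)$ and $X_n=E(X_{n-1},\omega)$, $\delta_n=\widehat{\delta_{n-1}}$ for $n\ge 1$. Identifying $X_{n-1}$ with its image in $X_n$ under $x\mapsto\kappa_x$, let $(X_\omega,\delta_\omega)$ be the union (direct limit) of the $(X_n,\delta_n)$. The completion of a diversity is the completion of its induced metric space, with the diversity function extended by continuity (i.e. so that $(a_1,\dots,a_k)\mapsto\delta(\{a_1,\dots,a_k\})$ is continuous for each $k$). $(\mathbb{U},\delta_{\mathbb{U}})$ is the completion of $(X_\omega,\delta_\omega)$ when $(X,\delta)$ is the diversity on a single point. *)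

theory Defs
  imports "HOL-Analysis.Analysis" "HOL-Library.FSet"
begin

text \<open>
  A diversity is given by a carrier \<open>X :: 'a set\<close> and a total function \<open>'a set \<Rightarrow> real\<close>, of
  which only the values on \<open>Fpow X\<close>, the finite subsets of the carrier, matter.
\<close>

definition diversity :: "'a set \<Rightarrow> ('a set \<Rightarrow> real) \<Rightarrow> bool" where
  "diversity X \<delta> \<longleftrightarrow>
     (\<forall>A\<in>Fpow X. 0 \<le> \<delta> A \<and> (\<delta> A = 0 \<longleftrightarrow> card A \<le> 1)) \<and>
     (\<forall>A\<in>Fpow X. \<forall>B\<in>Fpow X. \<forall>C\<in>Fpow X.
        B \<noteq> {} \<longrightarrow> \<delta> (A \<union> C) \<le> \<delta> (A \<union> B) + \<delta> (B \<union> C))"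

text \<open>The value outside the carrier is irrelevant; it is set to 0 because the locale
  \<open>Metric_space\<close> requires the distance to be nonnegative on the whole type.\<close>

definition induced_metric :: "'a set \<Rightarrow> ('a set \<Rightarrow> real) \<Rightarrow> 'a \<Rightarrow> 'a \<Rightarrow> real" where
  "induced_metric X \<delta> a b = (if a \<in> X \<and> b \<in> X then \<delta> {a, b} else 0)"

definition diversity_iso ::
    "'a set \<Rightarrow> ('a set \<Rightarrow> real) \<Rightarrow> 'b set \<Rightarrow> ('b set \<Rightarrow> real) \<Rightarrow> ('a \<Rightarrow> 'b) \<Rightarrow> bool" where
  "diversity_iso X \<delta>X Y \<delta>Y \<phi> \<longleftrightarrow>
     bij_betw \<phi> X Y \<and> (\<forall>A\<in>Fpow X. \<delta>Y (\<phi> ` A) = \<delta>X A)"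

definition ultrahomogeneous :: "'a set \<Rightarrow> ('a set \<Rightarrow> real) \<Rightarrow> bool" where
  "ultrahomogeneous X \<delta> \<longleftrightarrow>
     (\<forall>A A' \<phi>. A \<in> Fpow X \<and> A' \<in> Fpow X \<and> diversity_iso A \<delta> A' \<delta> \<phi> \<longrightarrow>
        (\<exists>\<psi>. diversity_iso X \<delta> X \<delta> \<psi> \<and> (\<forall>a\<in>A. \<psi> a = \<phi> a)))"

text \<open>
  The point \<open>z\<close> ranges over \<open>'a option\<close>, with \<open>X\<close> identified with \<open>Some ` X\<close>, so that a point
  outside \<open>X\<close> is available even when \<open>X\<close> is the whole type.
\<close>

definition admissible :: "'a set \<Rightarrow> ('a set \<Rightarrow> real) \<Rightarrow> ('a set \<Rightarrow> real) \<Rightarrow> bool" where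
  "admissible X \<delta> f \<longleftrightarrow>
     (\<exists>(z :: 'a option) \<delta>'. diversity (insert z (Some ` X)) \<delta>' \<and>
        (\<forall>A\<in>Fpow X. \<delta>' (Some ` A) = \<delta> A \<and> \<delta>' (insert z (Some ` A)) = f A))"

text \<open>Functions on the finite subsets of \<open>X\<close> are made extensional, so that HOL equality is
  equality on \<open>Fpow X\<close>.\<close>

definition E :: "'a set \<Rightarrow> ('a set \<Rightarrow> real) \<Rightarrow> ('a set \<Rightarrow> real) set" where
  "E X \<delta> = {f \<in> extensional (Fpow X). admissible X \<delta> f}"

definition kappa :: "'a set \<Rightarrow> ('a set \<Rightarrow> real) \<Rightarrow> 'a \<Rightarrow> ('a set \<Rightarrow> real)" where
  "kappa X \<delta> x = (\<lambda>A\<in>Fpow X. \<delta> (insert x A))"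

text \<open>In \<open>hat X F\<close> the family \<open>(A\<^sub>1, \<dots>, A\<^sub>k)\<close> is indexed by the members of
  \<open>F = {f\<^sub>1, \<dots>, f\<^sub>k}\<close> themselves.\<close>

definition hat :: "'a set \<Rightarrow> ('a set \<Rightarrow> real) set \<Rightarrow> real" where
  "hat X F =
     (if card F \<le> 1 then 0
      else Max ((\<lambda>f. SUP A \<in> F \<rightarrow> Fpow X.
                       f (\<Union>g\<in>F - {f}. A g) - (\<Sum>g\<in>F - {f}. g (A g))) ` F))"

definition support_ext ::
    "'a set \<Rightarrow> ('a set \<Rightarrow> real) \<Rightarrow> 'a set \<Rightarrow> ('a set \<Rightarrow> real) \<Rightarrow> ('a set \<Rightarrow> real)" where
  "support_ext X \<delta> S f =
     (\<lambda>A\<in>Fpow X. Inf {f B + (\<Sum>b\<in>B. \<delta> (insert b (P b))) | B P.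
                        B \<in> Fpow S \<and> (\<Union>b\<in>B. P b) = A})"

definition E_fin :: "'a set \<Rightarrow> ('a set \<Rightarrow> real) \<Rightarrow> ('a set \<Rightarrow> real) set" where
  "E_fin X \<delta> = {g \<in> E X \<delta>. \<exists>S f. finite S \<and> S \<noteq> {} \<and> S \<subseteq> X \<and> f \<in> E S \<delta> \<and>
                              g = support_ext X \<delta> S f}"

text \<open>
  Since \<open>E_fin X \<delta>\<close> lives in a larger type than \<open>X\<close>, the iterated construction is carried out on
  names. A finitely supported function \<open>support_ext X \<delta> S f\<close> on the \<open>n\<close>th stage is named
  \<open>Adj n G\<close>, where \<open>G\<close> is the graph of \<open>f\<close> on the subsets of \<open>S\<close>; which presentation \<open>(S, f)\<close> is
  used is an arbitrary choice, made once for each function. The functions \<open>kappa X \<delta> x\<close> are named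
  by \<open>x\<close> itself: this is the identification of each stage with its image in the next one. The
  tag \<open>n\<close> keeps the names of all other functions distinct from the points already present.
\<close>

datatype 'a pt = Base 'a | Adj nat "('a pt fset \<times> real) fset"

definition graph_on :: "'a fset \<Rightarrow> ('a set \<Rightarrow> real) \<Rightarrow> ('a fset \<times> real) fset" where
  "graph_on S f = (\<lambda>B. (B, f (fset B))) |`| fPow S"

definition name :: "nat \<Rightarrow> 'a pt set \<Rightarrow> ('a pt set \<Rightarrow> real) \<Rightarrow> ('a pt set \<Rightarrow> real) \<Rightarrow> 'a pt" where
  "name n X \<delta> g =
     (if g \<in> kappa X \<delta> ` X then inv_into X (kappa X \<delta>) g
      else SOME c. \<exists>S f. S \<noteq> {||} \<and> fset S \<subseteq> X \<and> f \<in> E (fset S) \<delta> \<and>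
                     g = support_ext X \<delta> (fset S) f \<and> c = Adj n (graph_on S f))"

primrec stage :: "'a set \<Rightarrow> ('a set \<Rightarrow> real) \<Rightarrow> nat \<Rightarrow> 'a pt set \<times> ('a pt set \<Rightarrow> real)" where
  "stage X \<delta> 0 = (Base ` X, \<lambda>A. \<delta> (Base -` A))"
| "stage X \<delta> (Suc n) =
     (let (Y, \<epsilon>) = stage X \<delta> n
      in (name n Y \<epsilon> ` E_fin Y \<epsilon>, \<lambda>A. hat Y {g \<in> E_fin Y \<epsilon>. name n Y \<epsilon> g \<in> A}))"

text \<open>The stages increase and their diversities extend one another, so the direct limit is the
  union, and a finite set may be measured in any stage that contains it.\<close>

definition limit_carrier :: "'a set \<Rightarrow> ('a set \<Rightarrow> real) \<Rightarrow> 'a pt set" where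
  "limit_carrier X \<delta> = (\<Union>n. fst (stage X \<delta> n))"

definition limit_div :: "'a set \<Rightarrow> ('a set \<Rightarrow> real) \<Rightarrow> 'a pt set \<Rightarrow> real" where
  "limit_div X \<delta> A = snd (stage X \<delta> (LEAST n. A \<subseteq> fst (stage X \<delta> n))) A"

text \<open>\<open>(U, \<delta>U)\<close> is a completion of \<open>(X, \<delta>)\<close> via \<open>\<iota> : X \<rightarrow> U\<close>: the induced metric space of \<open>U\<close> is a
  completion of that of \<open>X\<close>, and \<open>\<delta>U\<close> is the extension of \<open>\<delta>\<close> by continuity.\<close>

definition diversity_completion ::
    "'a set \<Rightarrow> ('a set \<Rightarrow> real) \<Rightarrow> 'b set \<Rightarrow> ('b set \<Rightarrow> real) \<Rightarrow> ('a \<Rightarrow> 'b) \<Rightarrow> bool" where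
  "diversity_completion X \<delta> U \<delta>U \<iota> \<longleftrightarrow>
     Metric_space U (induced_metric U \<delta>U) \<and>
     Metric_space.mcomplete U (induced_metric U \<delta>U) \<and>
     \<iota> \<in> X \<rightarrow> U \<and>
     Metric_space.mtopology U (induced_metric U \<delta>U) closure_of (\<iota> ` X) = U \<and>
     (\<forall>A\<in>Fpow X. \<delta>U (\<iota> ` A) = \<delta> A) \<and>
     (\<forall>k. continuous_map
            (product_topology (\<lambda>_. Metric_space.mtopology U (induced_metric U \<delta>U)) {..<k})
            euclideanreal (\<lambda>a. \<delta>U (a ` {..<k :: nat})))"

text \<open>The completion is determined only up to isomorphism; \<open>is_UU U \<delta>U\<close> says that \<open>(U, \<delta>U)\<close> is
  a completion of the direct limit obtained from the diversity on a single point.\<close>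

definition is_UU :: "'b set \<Rightarrow> ('b set \<Rightarrow> real) \<Rightarrow> bool" where
  "is_UU U \<delta>U \<longleftrightarrow>
     (\<exists>\<iota>. diversity_completion (limit_carrier {()} (\<lambda>_. 0)) (limit_div {()} (\<lambda>_. 0)) U \<delta>U \<iota>)"

end

theory Submission
  imports Defs
begin

text \<open>
  Every one-point extension of a finite subset of a stage is realized in the next stage by its
  finitely supported extension, so the direct limit realizes all one-point extensions of its
  finite subsets. By density the completion realizes them approximately; amalgamating an
  approximate solution with the exact one shows that approximate solutions can be improved by
  small moves, and the limit of the resulting Cauchy sequence is an exact solution.

  Each stage is separable: moving the support of a finitely supported function slightly, and then
  rounding its finitely many values, changes it little in the supremum norm, which is the metric
  of \<open>hat\<close>. Hence the completion is separable, and a back-and-forth construction along a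
  countable dense subset extends a finite partial isomorphism to one with dense domain and
  range, whose closure is the graph of an automorphism.
\<close>

section \<open>Diversities and admissible functions\<close>

text \<open>Admissibility is an existence statement. It is replaced by inequalities
  (\<open>adm\<close>) that survive restriction, pullback along isometries and the infimum in
  \<open>support_ext\<close>. Targets then arise from one source: distances to a point of any
  diversity that contains a copy of the set (\<open>adm_point\<close>). This gives both the amalgam
  in the improvement step and the transport of a new point in the back-and-forth step.

  The obstacle in the completion is that a finite subset of \<open>U\<close> need not lie in the
  dense part, where extensions are exact, and that nothing keeps independently chosen approximate
  solutions close to each other. Adding the previous approximate solution to the set over which one
  extends makes its distance to the next one part of the problem.

  Finite support serves separability: such a function is given by finitely many points and finitely
  many reals. Rounded reals need not be the values of an admissible function, so the countable dense
  set takes, for each pattern of rounded values, some admissible function that produces this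
  pattern. Separability in turn lets the back-and-forth construction treat one point per natural
  number.\<close>

lemma Fpow_iff: "A \<in> Fpow X \<longleftrightarrow> finite A \<and> A \<subseteq> X"
  by (auto simp: Fpow_def)

lemma diversity_zero: "diversity X \<delta> \<Longrightarrow> A \<in> Fpow X \<Longrightarrow> card A \<le> 1 \<Longrightarrow> \<delta> A = 0"
  by (auto simp: diversity_def)

lemma diversity_empty: "diversity X \<delta> \<Longrightarrow> \<delta> {} = 0"
  by (rule diversity_zero) (auto simp: Fpow_iff)

lemma diversity_singleton: "diversity X \<delta> \<Longrightarrow> x \<in> X \<Longrightarrow> \<delta> {x} = 0"
  by (rule diversity_zero) (auto simp: Fpow_iff)

lemma diversity_nonneg: "diversity X \<delta> \<Longrightarrow> A \<in> Fpow X \<Longrightarrow> 0 \<le> \<delta> A"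
  by (auto simp: diversity_def)

lemma diversity_triangle:
  "diversity X \<delta> \<Longrightarrow> A \<in> Fpow X \<Longrightarrow> B \<in> Fpow X \<Longrightarrow> C \<in> Fpow X \<Longrightarrow> B \<noteq> {} \<Longrightarrow>
    \<delta> (A \<union> C) \<le> \<delta> (A \<union> B) + \<delta> (B \<union> C)"
  by (auto simp: diversity_def)

lemma diversity_pair_eq_0:
  assumes "diversity X \<delta>" "x \<in> X" "y \<in> X" "\<delta> {x, y} = 0"
  shows "x = y"
proof (rule ccontr)
  assume "x \<noteq> y"
  then have "card {x, y} = 2" by simp
  moreover have "{x, y} \<in> Fpow X" using assms by (simp add: Fpow_iff)
  ultimately have "\<delta> {x, y} \<noteq> 0" using assms(1) unfolding diversity_def by force
  with assms show False by simp
qed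

text \<open>(D2) with a singleton in the middle and an empty third set shows that adding one point
  does not decrease the value, since singletons have value 0.\<close>

lemma diversity_mono:
  assumes d: "diversity X \<delta>" and "B \<in> Fpow X" "A \<subseteq> B"
  shows "\<delta> A \<le> \<delta> B"
proof -
  have "\<delta> A \<le> \<delta> (A \<union> C)" if "finite C" "C \<subseteq> X" "finite A" "A \<subseteq> X" for C
    using that
  proof (induction C)
    case (insert c C)
    have "\<delta> ((A \<union> C) \<union> {}) \<le> \<delta> ((A \<union> C) \<union> {c}) + \<delta> ({c} \<union> {})"
      by (rule diversity_triangle[OF d]) (use insert in \<open>auto simp: Fpow_iff\<close>)
    moreover have "\<delta> {c} = 0" using diversity_singleton[OF d] insert.prems by auto
    ultimately show ?case using insert by simp
  qed simp
  from this[of B] show ?thesis using assms finite_subset[of A B]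
    by (auto simp: Fpow_iff sup.absorb2)
qed

text \<open>(D2) with middle set \<open>A \<inter> B\<close>, which both \<open>A\<close> and
  \<open>B\<close> absorb.\<close>

lemma diversity_union:
  assumes d: "diversity X \<delta>" and "A \<in> Fpow X" "B \<in> Fpow X" "A \<inter> B \<noteq> {}"
  shows "\<delta> (A \<union> B) \<le> \<delta> A + \<delta> B"
proof -
  have "\<delta> (A \<union> B) \<le> \<delta> (A \<union> (A \<inter> B)) + \<delta> ((A \<inter> B) \<union> B)"
    by (rule diversity_triangle[OF d]) (use assms in \<open>auto simp: Fpow_iff\<close>)
  then show ?thesis by (simp add: sup.absorb1 sup.absorb2)
qed

text \<open>Monotonicity and subadditivity on overlapping sets give (D2): enlarge
  \<open>A \<union> C\<close> to the union of \<open>A \<union> B\<close> and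
  \<open>B \<union> C\<close>, which overlap in \<open>B\<close>. In this form the axioms are
  checked for \<open>hat\<close>, for images and for limits.\<close>

lemma diversityI:
  assumes nn: "\<And>A. A \<in> Fpow X \<Longrightarrow> 0 \<le> \<delta> A"
    and zero: "\<And>A. A \<in> Fpow X \<Longrightarrow> \<delta> A = 0 \<longleftrightarrow> card A \<le> 1"
    and mono: "\<And>A B. B \<in> Fpow X \<Longrightarrow> A \<subseteq> B \<Longrightarrow> \<delta> A \<le> \<delta> B"
    and union: "\<And>A B. A \<in> Fpow X \<Longrightarrow> B \<in> Fpow X \<Longrightarrow> A \<inter> B \<noteq> {} \<Longrightarrow> \<delta> (A \<union> B) \<le> \<delta> A + \<delta> B"
  shows "diversity X \<delta>"
  unfolding diversity_def
proof (intro conjI ballI impI)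
  fix A B C assume *: "A \<in> Fpow X" "B \<in> Fpow X" "C \<in> Fpow X" "B \<noteq> {}"
  have "\<delta> (A \<union> C) \<le> \<delta> ((A \<union> B) \<union> (B \<union> C))"
    by (rule mono) (use * in \<open>auto simp: Fpow_iff\<close>)
  also have "\<dots> \<le> \<delta> (A \<union> B) + \<delta> (B \<union> C)"
    by (rule union) (use * in \<open>auto simp: Fpow_iff\<close>)
  finally show "\<delta> (A \<union> C) \<le> \<delta> (A \<union> B) + \<delta> (B \<union> C)" .
qed (use nn zero in auto)

lemma diversity_subset: "diversity X \<delta> \<Longrightarrow> Y \<subseteq> X \<Longrightarrow> diversity Y \<delta>"
  unfolding diversity_def by (meson Fpow_mono subsetD)

text \<open>Only \<open>\<delta>\<close> is known to be a diversity; two points with the same image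
  have the \<open>\<delta>\<close>-value of a singleton, which is 0. This is why
  \<open>diversity_image\<close> can conclude that \<open>\<rho>\<close> is a diversity.\<close>

lemma isometry_inj_on:
  assumes "diversity X \<delta>" "\<And>A. A \<in> Fpow X \<Longrightarrow> \<rho> (j ` A) = \<delta> A"
  shows "inj_on j X"
proof (rule inj_onI)
  fix x y assume xy: "x \<in> X" "y \<in> X" "j x = j y"
  have "\<delta> {x, y} = \<rho> (j ` {x, y})" using assms(2)[of "{x, y}"] xy by (simp add: Fpow_iff)
  also have "\<dots> = \<rho> (j ` {x})" using xy by simp
  also have "\<dots> = 0" using assms(2)[of "{x}"] xy diversity_singleton[OF assms(1)] by (simp add: Fpow_iff)
  finally show "x = y" using diversity_pair_eq_0 assms xy by metis
qed

lemma Fpow_imageE: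
  assumes "B \<in> Fpow (j ` X)"
  obtains A where "A \<in> Fpow X" "B = j ` A"
  using assms by (auto simp: Fpow_iff dest: finite_subset_image)

lemma diversity_image:
  assumes d: "diversity X \<delta>" and iso: "\<And>A. A \<in> Fpow X \<Longrightarrow> \<rho> (j ` A) = \<delta> A"
  shows "diversity (j ` X) \<rho>"
proof -
  have card: "card (j ` A) = card A" if "A \<in> Fpow X" for A
    using card_image[OF inj_on_subset[OF isometry_inj_on[OF d iso]]] that by (simp add: Fpow_iff)
  show ?thesis
  proof (rule diversityI)
    fix B assume B: "B \<in> Fpow (j ` X)"
    obtain B' where B': "B' \<in> Fpow X" "B = j ` B'" using B by (rule Fpow_imageE)
    show "0 \<le> \<rho> B" using iso[OF B'(1)] diversity_nonneg[OF d B'(1)] B' by simp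
    show "\<rho> B = 0 \<longleftrightarrow> card B \<le> 1"
      using iso[OF B'(1)] card[OF B'(1)] B' d unfolding diversity_def by simp
    { fix A assume "A \<subseteq> B"
      then obtain A' where A': "A' \<subseteq> B'" "A = j ` A'" using B' by (auto simp: subset_image_iff)
      then have "A' \<in> Fpow X" using B' by (auto simp: Fpow_iff intro: finite_subset)
      then show "\<rho> A \<le> \<rho> B"
        using A' B' iso diversity_mono[OF d B'(1) A'(1)] by simp }
    fix A assume A: "A \<in> Fpow (j ` X)" "A \<inter> B \<noteq> {}"
    obtain A' where A': "A' \<in> Fpow X" "A = j ` A'" using A(1) by (rule Fpow_imageE)
    have "A' \<union> B' \<in> Fpow X" using A' B' by (simp add: Fpow_iff)
    moreover have "A' \<inter> B' \<noteq> {}"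
    proof -
      obtain x y where "x \<in> A'" "y \<in> B'" "j x = j y" using A(2) A' B' by auto
      moreover from this have "x = y"
        using isometry_inj_on[OF d iso] A' B' by (auto simp: Fpow_iff inj_on_def)
      ultimately show ?thesis by blast
    qed
    ultimately show "\<rho> (A \<union> B) \<le> \<rho> A + \<rho> B"
      using diversity_union[OF d A'(1) B'(1)] iso[of "A' \<union> B'"] iso[OF A'(1)] iso[OF B'(1)] A' B'
      by (simp add: image_Un)
  qed
qed

text \<open>Isolates what the distance function of a point shares with \<open>\<delta>\<close>
  itself, so that the star and Lipschitz estimates below cover both.\<close>

definition compatible :: "'a set \<Rightarrow> ('a set \<Rightarrow> real) \<Rightarrow> ('a set \<Rightarrow> real) \<Rightarrow> bool" where
  "compatible X \<delta> f \<longleftrightarrow>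
     (\<forall>A B. B \<in> Fpow X \<longrightarrow> A \<subseteq> B \<longrightarrow> f A \<le> f B) \<and>
     (\<forall>A\<in>Fpow X. \<forall>C\<in>Fpow X. A \<inter> C \<noteq> {} \<longrightarrow> f (A \<union> C) \<le> f A + \<delta> C)"

text \<open>If \<open>z\<close> lies in \<open>X\<close>, its distance function is \<open>kappa X \<delta> z\<close>; otherwise it is positive on
  nonempty sets. This dichotomy follows from the inequalities below, so no positivity
  condition is needed to characterize admissibility.\<close>

definition adm :: "'a set \<Rightarrow> ('a set \<Rightarrow> real) \<Rightarrow> ('a set \<Rightarrow> real) \<Rightarrow> bool" where
  "adm X \<delta> f \<longleftrightarrow> compatible X \<delta> f \<and> f {} = 0 \<and>
     (\<forall>A\<in>Fpow X. \<forall>B\<in>Fpow X. \<delta> (A \<union> B) \<le> f A + f B \<and> f (A \<union> B) \<le> f A + f B)"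

lemma diversity_compatible: "diversity X \<delta> \<Longrightarrow> compatible X \<delta> \<delta>"
  unfolding compatible_def using diversity_mono diversity_union by blast

lemma compatible_mono: "compatible X \<delta> f \<Longrightarrow> B \<in> Fpow X \<Longrightarrow> A \<subseteq> B \<Longrightarrow> f A \<le> f B"
  by (auto simp: compatible_def)

lemma compatible_union:
  "compatible X \<delta> f \<Longrightarrow> A \<in> Fpow X \<Longrightarrow> C \<in> Fpow X \<Longrightarrow> A \<inter> C \<noteq> {} \<Longrightarrow> f (A \<union> C) \<le> f A + \<delta> C"
  by (auto simp: compatible_def)

lemma adm_compatible: "adm X \<delta> f \<Longrightarrow> compatible X \<delta> f" by (simp add: adm_def)
lemma adm_empty: "adm X \<delta> f \<Longrightarrow> f {} = 0" by (simp add: adm_def)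
lemma adm_ge: "adm X \<delta> f \<Longrightarrow> A \<in> Fpow X \<Longrightarrow> B \<in> Fpow X \<Longrightarrow> \<delta> (A \<union> B) \<le> f A + f B"
  by (simp add: adm_def)
lemma adm_union: "adm X \<delta> f \<Longrightarrow> A \<in> Fpow X \<Longrightarrow> B \<in> Fpow X \<Longrightarrow> f (A \<union> B) \<le> f A + f B"
  by (simp add: adm_def)
lemmas adm_mono = compatible_mono[OF adm_compatible]

lemma adm_nonneg: "adm X \<delta> f \<Longrightarrow> A \<in> Fpow X \<Longrightarrow> 0 \<le> f A"
  using adm_mono[of X \<delta> f A "{}"] adm_empty[of X \<delta> f] by simp

lemma adm_subset:
  assumes "adm X \<delta> f" "Y \<subseteq> X" shows "adm Y \<delta> f"
proof -
  have "A \<in> Fpow X" if "A \<in> Fpow Y" for A using that assms by (auto simp: Fpow_iff)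
  then show ?thesis using assms(1) by (simp add: adm_def compatible_def)
qed

lemma adm_cong:
  assumes "adm X \<delta> f" and eq: "\<And>A. A \<in> Fpow X \<Longrightarrow> f A = g A"
  shows "adm X \<delta> g"
proof -
  have "g A \<le> g B" if "B \<in> Fpow X" "A \<subseteq> B" for A B
    using adm_mono[OF assms(1) that] eq[of A] eq[of B] that finite_subset[of A B] by (auto simp: Fpow_iff)
  then show ?thesis
    using assms(1) eq[of "{}"] eq unfolding adm_def compatible_def
    by (auto simp: Fpow_iff)
qed

text \<open>Each \<open>P i\<close> together with its base point \<open>b i\<close> in
  \<open>C\<close> meets the set built so far and so adds at most its own value. The sums in
  \<open>support_ext\<close> have exactly this shape, and those in \<open>hat\<close> are compared
  with it.\<close>

lemma compatible_star:
  assumes f: "compatible X \<delta> f" and "finite I" "C \<in> Fpow X" "b ` I \<subseteq> C" "\<And>i. i \<in> I \<Longrightarrow> P i \<in> Fpow X"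
  shows "f (C \<union> (\<Union>i\<in>I. P i)) \<le> f C + (\<Sum>i\<in>I. \<delta> (insert (b i) (P i)))"
  using assms(2,4,5)
proof (induction I)
  case (insert i I)
  have 1: "insert (b i) (P i) \<in> Fpow X" "C \<union> (\<Union>i\<in>I. P i) \<in> Fpow X"
    using insert assms(3) by (auto simp: Fpow_iff)
  have "f ((C \<union> (\<Union>i\<in>I. P i)) \<union> insert (b i) (P i)) \<le> f (C \<union> (\<Union>i\<in>I. P i)) + \<delta> (insert (b i) (P i))"
    by (rule compatible_union[OF f 1(2,1)]) (use insert in auto)
  moreover have "(C \<union> (\<Union>i\<in>I. P i)) \<union> insert (b i) (P i) = C \<union> (\<Union>i\<in>insert i I. P i)"
    using insert by auto
  ultimately show ?case using insert by auto
qed simp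

lemma compatible_star_Union:
  assumes "compatible X \<delta> f" and "finite I" "C \<in> Fpow X" "b ` I \<subseteq> C" "\<And>i. i \<in> I \<Longrightarrow> P i \<in> Fpow X"
  shows "f (\<Union>i\<in>I. P i) \<le> f C + (\<Sum>i\<in>I. \<delta> (insert (b i) (P i)))"
proof -
  have "f (\<Union>i\<in>I. P i) \<le> f (C \<union> (\<Union>i\<in>I. P i))"
    by (rule compatible_mono[OF assms(1)]) (use assms in \<open>auto simp: Fpow_iff\<close>)
  with compatible_star[of X \<delta> f I C b P, OF assms] show ?thesis by linarith
qed

text \<open>Star estimate with the singletons \<open>{h i}\<close> hung on the base points
  \<open>g i\<close>. Indexing by \<open>I\<close> instead of by points pays off in
  \<open>partial_iso_rel_closure\<close>, where the two projections are not yet known to be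
  injective.\<close>

lemma compatible_lipschitz_family:
  assumes "compatible X \<delta> f" "finite I" "g ` I \<subseteq> X" "h ` I \<subseteq> X"
  shows "\<bar>f (h ` I) - f (g ` I)\<bar> \<le> (\<Sum>i\<in>I. \<delta> {g i, h i})"
proof -
  have *: "f (h ` I) \<le> f (g ` I) + (\<Sum>i\<in>I. \<delta> {g i, h i})" if "g ` I \<subseteq> X" "h ` I \<subseteq> X" for g h
  proof -
    have "f (\<Union>i\<in>I. {h i}) \<le> f (g ` I) + (\<Sum>i\<in>I. \<delta> (insert (g i) {h i}))"
      by (rule compatible_star_Union[OF assms(1,2)]) (use assms(2) that in \<open>auto simp: Fpow_iff\<close>)
    moreover have "(\<Union>i\<in>I. {h i}) = h ` I" by auto
    ultimately show ?thesis by simp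
  qed
  show ?thesis using *[OF assms(3,4)] *[OF assms(4,3)] by (simp add: insert_commute abs_le_iff)
qed

lemma compatible_lipschitz:
  assumes "compatible X \<delta> f" "A \<in> Fpow X" "h ` A \<subseteq> X"
  shows "\<bar>f (h ` A) - f A\<bar> \<le> (\<Sum>a\<in>A. \<delta> {a, h a})"
  using compatible_lipschitz_family[of X \<delta> f A "\<lambda>a. a" h] assms by (simp add: Fpow_iff)

text \<open>The source of admissible functions: \<open>z\<close> may be an arbitrary point of an
  arbitrary diversity that contains an isometric copy of \<open>X\<close>, possibly a point of the
  copy itself.\<close>

lemma adm_point:
  assumes \<rho>: "diversity Z \<rho>" and j: "j ` X \<subseteq> Z" "\<And>A. A \<in> Fpow X \<Longrightarrow> \<rho> (j ` A) = \<delta> A"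
    and z: "z \<in> Z"
  shows "adm X \<delta> (\<lambda>A. \<rho> (insert z (j ` A)))"
proof -
  have mem: "insert z (j ` A) \<in> Fpow Z" "j ` A \<in> Fpow Z" if "A \<in> Fpow X" for A
    using that j z by (auto simp: Fpow_iff)
  have union: "\<rho> (insert z (j ` (A \<union> B))) \<le> \<rho> (insert z (j ` A)) + \<rho> (insert z (j ` B))"
    if "A \<in> Fpow X" "B \<in> Fpow X" for A B
    using diversity_union[OF \<rho> mem(1)[OF that(1)] mem(1)[OF that(2)]] by (simp add: image_Un)
  show ?thesis
    unfolding adm_def compatible_def
  proof (intro conjI ballI allI impI)
    fix A B assume "B \<in> Fpow X" "A \<subseteq> B"
    then show "\<rho> (insert z (j ` A)) \<le> \<rho> (insert z (j ` B))"
      by (intro diversity_mono[OF \<rho> mem(1)]) auto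
  next
    fix A C assume *: "A \<in> Fpow X" "C \<in> Fpow X" "A \<inter> C \<noteq> {}"
    have "\<rho> (insert z (j ` A) \<union> j ` C) \<le> \<rho> (insert z (j ` A)) + \<rho> (j ` C)"
      by (rule diversity_union[OF \<rho>]) (use * mem in auto)
    then show "\<rho> (insert z (j ` (A \<union> C))) \<le> \<rho> (insert z (j ` A)) + \<delta> C"
      using * j(2)[of C] by (simp add: image_Un)
  next
    fix A B assume *: "A \<in> Fpow X" "B \<in> Fpow X"
    then have "A \<union> B \<in> Fpow X" by (auto simp: Fpow_iff)
    then have "\<delta> (A \<union> B) \<le> \<rho> (insert z (j ` (A \<union> B)))"
      using j(2)[of "A \<union> B"] diversity_mono[OF \<rho> mem(1), of "A \<union> B" "j ` (A \<union> B)"] by auto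
    with union[OF *] show "\<delta> (A \<union> B) \<le> \<rho> (insert z (j ` A)) + \<rho> (insert z (j ` B))" by simp
  qed (use union diversity_singleton[OF \<rho>] z in auto)
qed

lemma adm_kappa:
  assumes "diversity X \<delta>" "x \<in> X" shows "adm X \<delta> (\<lambda>A. \<delta> (insert x A))"
  using adm_point[of X \<delta> "\<lambda>x. x" X \<delta> x] assms by simp

text \<open>A zero at \<open>x\<close> means that the new point coincides with \<open>x\<close>.
  Compatibility on \<open>{x}\<close> and \<open>insert x A\<close> gives the upper bound,
  \<open>adm_ge\<close> on \<open>{x}\<close> and \<open>A\<close> the lower one.\<close>

lemma adm_eq_kappa:
  assumes d: "diversity X \<delta>" and f: "adm X \<delta> f" and "x \<in> X" "f {x} = 0" "A \<in> Fpow X"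
  shows "f A = \<delta> (insert x A)"
proof (rule antisym)
  have "{x} \<in> Fpow X" "insert x A \<in> Fpow X" using assms by (auto simp: Fpow_iff)
  then show "f A \<le> \<delta> (insert x A)"
    using compatible_union[OF adm_compatible[OF f], of "{x}" "insert x A"]
      adm_mono[OF f, of "insert x A" A] assms by (auto simp: subset_insertI)
  show "\<delta> (insert x A) \<le> f A"
    using adm_ge[OF f, of "{x}" A] assms by (auto simp: Fpow_iff)
qed

text \<open>Without zeros the new point \<open>None\<close> is kept apart from \<open>X\<close>.
  Subadditivity on overlapping sets splits by where \<open>None\<close> lies: in both sets
  (\<open>adm_union\<close>), in one (\<open>compatible_union\<close>), or in neither
  (\<open>\<delta>\<close> itself).\<close>

lemma adm_diversity_option:
  assumes d: "diversity X \<delta>" and f: "adm X \<delta> f" and pos: "\<And>x. x \<in> X \<Longrightarrow> f {x} \<noteq> 0"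
  shows "diversity (insert None (Some ` X)) (\<lambda>A. if None \<in> A then f (Some -` A) else \<delta> (Some -` A))"
    (is "diversity ?Z ?\<rho>")
proof (rule diversityI)
  have vim: "Some -` A \<in> Fpow X" if "A \<in> Fpow ?Z" for A
    using that by (auto simp: Fpow_iff intro!: finite_vimageI)
  have le: "\<delta> A \<le> f A" if "A \<in> Fpow X" for A
    using adm_ge[OF f that, of "{}"] adm_empty[OF f] by (simp add: Fpow_iff)
  { fix A assume A: "A \<in> Fpow ?Z"
    show "0 \<le> ?\<rho> A" using vim[OF A] adm_nonneg[OF f] diversity_nonneg[OF d] by auto
    show "?\<rho> A = 0 \<longleftrightarrow> card A \<le> 1"
    proof (cases "None \<in> A")
      case True
      then have A': "A = insert None (Some ` (Some -` A))"
        by (intro set_eqI, case_tac x) auto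
      have "card A = Suc (card (Some -` A))"
        using arg_cong[OF A', of card] vim[OF A] by (simp add: card_image Fpow_iff del: image_vimage_eq)
      moreover have "f (Some -` A) = 0 \<longleftrightarrow> Some -` A = {}"
      proof
        assume 0: "f (Some -` A) = 0"
        { fix x assume "x \<in> Some -` A"
          then have "f {x} \<le> 0" "{x} \<in> Fpow X"
            using adm_mono[OF f vim[OF A], of "{x}"] 0 vim[OF A] by (auto simp: Fpow_iff)
          then have False using pos[of x] adm_nonneg[OF f, of "{x}"] by (auto simp: Fpow_iff) }
        then show "Some -` A = {}" by blast
      qed (use adm_empty[OF f] in simp)
      moreover have "finite (Some -` A)" using vim[OF A] by (auto simp: Fpow_iff)
      ultimately show ?thesis using True by auto
    next
      case False
      then have A': "A = Some ` (Some -` A)"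
        by (intro set_eqI, case_tac x) auto
      have "card A = card (Some -` A)"
        using arg_cong[OF A', of card] by (simp add: card_image del: image_vimage_eq)
      then show ?thesis using False vim[OF A] d unfolding diversity_def by auto
    qed
  }
  fix A B assume B: "B \<in> Fpow ?Z"
  { assume "A \<subseteq> B"
    then have A: "A \<in> Fpow ?Z" and AB: "Some -` A \<subseteq> Some -` B"
      using B by (auto simp: Fpow_iff intro: finite_subset)
    show "?\<rho> A \<le> ?\<rho> B"
      using adm_mono[OF f vim[OF B] AB] diversity_mono[OF d vim[OF B] AB] le[OF vim[OF A]]
        \<open>A \<subseteq> B\<close> by auto }
  assume A: "A \<in> Fpow ?Z" and AB: "A \<inter> B \<noteq> {}"
  have ne: "Some -` A \<inter> Some -` B \<noteq> {}" if "None \<notin> A \<or> None \<notin> B"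
  proof -
    obtain z where "z \<in> A \<inter> B" using AB by blast
    with that show ?thesis by (cases z) auto
  qed
  show "?\<rho> (A \<union> B) \<le> ?\<rho> A + ?\<rho> B"
    using adm_union[OF f vim[OF A] vim[OF B]] diversity_union[OF d vim[OF A] vim[OF B]] ne
      compatible_union[OF adm_compatible[OF f] vim[OF A] vim[OF B]]
      compatible_union[OF adm_compatible[OF f] vim[OF B] vim[OF A]]
    by (auto simp: Un_commute Int_commute)
qed

text \<open>The point \<open>z\<close> is \<open>Some x\<close> if \<open>f\<close> vanishes at a
  point \<open>x\<close> of \<open>X\<close>, and \<open>None\<close> otherwise.\<close>

lemma admissible_iff_adm:
  assumes d: "diversity X \<delta>"
  shows "admissible X \<delta> f \<longleftrightarrow> adm X \<delta> f"
proof
  assume "admissible X \<delta> f"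
  then obtain z :: "'a option" and \<rho> where \<rho>: "diversity (insert z (Some ` X)) \<rho>"
    and eq: "\<And>A. A \<in> Fpow X \<Longrightarrow> \<rho> (Some ` A) = \<delta> A" "\<And>A. A \<in> Fpow X \<Longrightarrow> \<rho> (insert z (Some ` A)) = f A"
    unfolding admissible_def by blast
  have "adm X \<delta> (\<lambda>A. \<rho> (insert z (Some ` A)))"
    by (rule adm_point[OF \<rho>]) (use eq in auto)
  then show "adm X \<delta> f" by (rule adm_cong) (simp add: eq)
next
  assume f: "adm X \<delta> f"
  show "admissible X \<delta> f"
  proof (cases "\<exists>x\<in>X. f {x} = 0")
    case True
    then obtain x where x: "x \<in> X" "f {x} = 0" by blast
    have "diversity (Some ` X) (\<lambda>A. \<delta> (Some -` A))"
      by (rule diversity_image[OF d]) (simp add: inj_vimage_image_eq)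
    moreover have "insert (Some x) (Some ` X) = Some ` X" using x by auto
    moreover have "\<delta> (Some -` insert (Some x) (Some ` A)) = f A" if "A \<in> Fpow X" for A
      using adm_eq_kappa[OF d f x that] inj_vimage_image_eq[OF inj_Some, of "insert x A"] by simp
    ultimately show ?thesis
      unfolding admissible_def
      by (intro exI[of _ "Some x"] exI[of _ "\<lambda>A. \<delta> (Some -` A)"]) (simp add: inj_vimage_image_eq)
  next
    case False
    have "Some -` insert None (Some ` A) = A" for A :: "'a set" by auto
    then show ?thesis
      unfolding admissible_def using adm_diversity_option[OF d f] False
      by (intro exI[of _ None] exI[of _ "\<lambda>A. if None \<in> A then f (Some -` A) else \<delta> (Some -` A)"])
        (auto simp: inj_vimage_image_eq)
  qed
qed

lemma E_iff: "diversity X \<delta> \<Longrightarrow> f \<in> E X \<delta> \<longleftrightarrow> f \<in> extensional (Fpow X) \<and> adm X \<delta> f"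
  by (simp add: E_def admissible_iff_adm)

lemma E_adm: "diversity X \<delta> \<Longrightarrow> f \<in> E X \<delta> \<Longrightarrow> adm X \<delta> f"
  by (simp add: E_iff)

lemma restrict_in_E:
  assumes "diversity X \<delta>" "adm X \<delta> f" shows "restrict f (Fpow X) \<in> E X \<delta>"
  using assms by (auto simp: E_iff intro: adm_cong)

lemma kappa_in_E: "diversity X \<delta> \<Longrightarrow> x \<in> X \<Longrightarrow> kappa X \<delta> x \<in> E X \<delta>"
  unfolding kappa_def by (intro restrict_in_E adm_kappa)

lemma inj_on_kappa:
  assumes d: "diversity X \<delta>" shows "inj_on (kappa X \<delta>) X"
proof (rule inj_onI)
  fix x y assume xy: "x \<in> X" "y \<in> X" "kappa X \<delta> x = kappa X \<delta> y"
  then have "kappa X \<delta> x {y} = kappa X \<delta> y {y}" by simp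
  then have "\<delta> {x, y} = \<delta> {y}" using xy by (simp add: kappa_def Fpow_iff)
  then show "x = y" using diversity_pair_eq_0[OF d] diversity_singleton[OF d] xy by metis
qed

section \<open>The diversity on the set of admissible functions\<close>

definition hat_val :: "('a set \<Rightarrow> real) set \<Rightarrow> ('a set \<Rightarrow> real) \<Rightarrow> (('a set \<Rightarrow> real) \<Rightarrow> 'a set) \<Rightarrow> real" where
  "hat_val F f P = f (\<Union>g\<in>F - {f}. P g) - (\<Sum>g\<in>F - {f}. g (P g))"

lemma hat_alt:
  "hat X F = (if card F \<le> 1 then 0 else Max ((\<lambda>f. SUP P \<in> F \<rightarrow> Fpow X. hat_val F f P) ` F))"
  by (simp add: hat_def hat_val_def)

lemma UN_in_Fpow: "finite I \<Longrightarrow> (\<And>i. i \<in> I \<Longrightarrow> P i \<in> Fpow X) \<Longrightarrow> (\<Union>i\<in>I. P i) \<in> Fpow X"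
  by (auto simp: Fpow_iff)

lemma Fpow_Un: "A \<in> Fpow X \<Longrightarrow> B \<in> Fpow X \<Longrightarrow> A \<union> B \<in> Fpow X"
  by (auto simp: Fpow_iff)

lemma E_eqI:
  assumes "diversity X \<delta>" "f \<in> E X \<delta>" "g \<in> E X \<delta>" "\<And>A. A \<in> Fpow X \<Longrightarrow> f A = g A"
  shows "f = g"
  using assms by (auto simp: E_iff intro: extensionalityI)

context
  fixes X :: "'a set" and \<delta> :: "'a set \<Rightarrow> real"
  assumes d: "diversity X \<delta>" and ne: "X \<noteq> {}"
begin

lemma Fpow_E_adm: "F \<in> Fpow (E X \<delta>) \<Longrightarrow> f \<in> F \<Longrightarrow> adm X \<delta> f"
  using E_adm[OF d] by (auto simp: Fpow_iff)

text \<open>Ensures that the suprema in \<open>hat\<close> are over bounded sets. All sets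
  \<open>P g\<close> are hung on the same base point \<open>x\<close>, and
  \<open>\<delta> (insert x (P g)) \<le> g {x} + g (P g)\<close>.\<close>

lemma hat_val_bound:
  assumes x: "x \<in> X" and F: "F \<in> Fpow (E X \<delta>)" "f \<in> F" and P: "P \<in> F \<rightarrow> Fpow X"
  shows "hat_val F f P \<le> (\<Sum>g\<in>F. g {x})"
proof -
  have "finite F" using F by (simp add: Fpow_iff)
  have "f (\<Union>g\<in>F-{f}. P g) \<le> f {x} + (\<Sum>g\<in>F-{f}. \<delta> (insert x (P g)))"
    by (rule compatible_star_Union[OF adm_compatible[OF Fpow_E_adm[OF F]]])
      (use x P \<open>finite F\<close> in \<open>auto simp: Fpow_iff Pi_iff\<close>)
  also have "(\<Sum>g\<in>F-{f}. \<delta> (insert x (P g))) \<le> (\<Sum>g\<in>F-{f}. g {x} + g (P g))"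
  proof (rule sum_mono)
    fix g assume g: "g \<in> F - {f}"
    show "\<delta> (insert x (P g)) \<le> g {x} + g (P g)"
      using adm_ge[OF Fpow_E_adm[OF F(1), of g], of "{x}" "P g"] g P x by (auto simp: Fpow_iff Pi_iff)
  qed
  finally show ?thesis
    using \<open>finite F\<close> F(2) by (simp add: hat_val_def sum.distrib sum.remove[of F f])
qed

lemma hat_val_singleton: "adm X \<delta> f \<Longrightarrow> hat_val {f} f P = 0"
  by (simp add: hat_val_def adm_empty)

lemma card_le_1_singleton: "F \<in> Fpow Y \<Longrightarrow> card F \<le> 1 \<Longrightarrow> f \<in> F \<Longrightarrow> F = {f}"
  using card_le_Suc0_iff_eq[of F] by (auto simp: Fpow_iff)

text \<open>With \<open>hat_le\<close>, this replaces the maximum of suprema for nonempty families.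
  A family of one function fits in because \<open>hat_val {f} f P = f {} = 0\<close>.\<close>

lemma hat_ge:
  assumes F: "F \<in> Fpow (E X \<delta>)" "f \<in> F" and P: "P \<in> F \<rightarrow> Fpow X"
  shows "hat_val F f P \<le> hat X F"
proof (cases "card F \<le> 1")
  case True
  then have "F = {f}" using card_le_1_singleton[OF F(1)] F(2) by blast
  then show ?thesis using hat_val_singleton[OF Fpow_E_adm[OF F]] by (simp add: hat_alt)
next
  case False
  obtain x where "x \<in> X" using ne by blast
  have "bdd_above (hat_val F f ` (F \<rightarrow> Fpow X))"
    by (rule bdd_aboveI2) (rule hat_val_bound[OF \<open>x \<in> X\<close> F])
  then have "hat_val F f P \<le> (SUP P \<in> F \<rightarrow> Fpow X. hat_val F f P)"
    using P by (intro cSUP_upper)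
  also have "\<dots> \<le> hat X F"
    using False F by (auto simp: hat_alt Fpow_iff intro!: Max_ge)
  finally show ?thesis .
qed

lemma hat_le:
  assumes F: "F \<in> Fpow (E X \<delta>)" "F \<noteq> {}"
    and le: "\<And>f P. f \<in> F \<Longrightarrow> P \<in> F \<rightarrow> Fpow X \<Longrightarrow> hat_val F f P \<le> c"
  shows "hat X F \<le> c"
proof (cases "card F \<le> 1")
  case True
  obtain f where f: "f \<in> F" using F by blast
  with True have "F = {f}" using card_le_1_singleton[OF F(1)] f by blast
  then show ?thesis
    using le[OF f, of "\<lambda>_. {}"] hat_val_singleton[OF Fpow_E_adm[OF F(1) f]] by (simp add: hat_alt Fpow_iff)
next
  case False
  have "(\<lambda>_. {}) \<in> F \<rightarrow> Fpow X" by (simp add: Fpow_iff)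
  then have "(SUP P \<in> F \<rightarrow> Fpow X. hat_val F f P) \<le> c" if "f \<in> F" for f
    using le[OF that] by (intro cSUP_least) auto
  then show ?thesis using False F by (simp add: hat_alt Fpow_iff)
qed

lemma hat_nonneg:
  assumes F: "F \<in> Fpow (E X \<delta>)" shows "0 \<le> hat X F"
proof (cases "F = {}")
  case False
  then obtain f where f: "f \<in> F" by blast
  have "hat_val F f (\<lambda>_. {}) = 0"
    unfolding hat_val_def using adm_empty[OF Fpow_E_adm[OF F]] f by (simp add: sum.neutral)
  with hat_ge[OF F f, of "\<lambda>_. {}"] show ?thesis by (simp add: Fpow_iff)
qed (simp add: hat_alt)

text \<open>Empty sets at the functions outside \<open>I\<close> contribute nothing to the union,
  and nothing to the sum because \<open>g {} = 0\<close>. Families on a part of \<open>G\<close> can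
  thus be tested in \<open>G\<close>.\<close>

lemma hat_val_extend:
  assumes G: "G \<in> Fpow (E X \<delta>)" and "I \<subseteq> G - {f}"
  shows "hat_val G f (\<lambda>g. if g \<in> I then P g else {}) = f (\<Union>g\<in>I. P g) - (\<Sum>g\<in>I. g (P g))"
proof -
  have "(\<Union>g\<in>G - {f}. if g \<in> I then P g else {}) = (\<Union>g\<in>I. P g)" using assms by auto
  moreover have "(\<Sum>g\<in>G - {f}. g (if g \<in> I then P g else {})) = (\<Sum>g\<in>I. g (P g))"
    by (rule sum.mono_neutral_cong_right)
      (use assms adm_empty[OF Fpow_E_adm[OF G]] in \<open>auto simp: Fpow_iff\<close>)
  ultimately show ?thesis by (simp add: hat_val_def)
qed

lemma hat_mono:
  assumes G: "G \<in> Fpow (E X \<delta>)" and FG: "F \<subseteq> G"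
  shows "hat X F \<le> hat X G"
proof (cases "F = {}")
  case True
  then show ?thesis using hat_nonneg[OF G] by (simp add: hat_alt)
next
  case False
  have F: "F \<in> Fpow (E X \<delta>)" using G FG by (auto simp: Fpow_iff intro: finite_subset)
  show ?thesis
  proof (rule hat_le[OF F False])
    fix f P assume f: "f \<in> F" and P: "P \<in> F \<rightarrow> Fpow X"
    have "hat_val F f P = hat_val G f (\<lambda>g. if g \<in> F - {f} then P g else {})"
      by (subst hat_val_extend[OF G]) (use FG in \<open>auto simp: hat_val_def\<close>)
    also have "\<dots> \<le> hat X G"
      by (rule hat_ge[OF G]) (use f FG P in \<open>auto simp: Fpow_iff\<close>)
    finally show "hat_val F f P \<le> hat X G" .
  qed
qed

text \<open>The sets assigned to \<open>G - F\<close> have union \<open>?Q\<close>, and any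
  \<open>k\<close> common to \<open>F\<close> and \<open>G\<close> satisfies
  \<open>k ?Q \<le> hat X G + (\<Sum>g\<in>G - F. g (P g))\<close>. If \<open>f\<close> is common,
  subadditivity of \<open>f\<close> separates \<open>?R\<close> from \<open>?Q\<close>; otherwise
  the common function \<open>h\<close> acts as a relay.\<close>

lemma hat_val_union:
  assumes F: "F \<in> Fpow (E X \<delta>)" and G: "G \<in> Fpow (E X \<delta>)" and h: "h \<in> F" "h \<in> G"
    and f: "f \<in> F" and P: "P \<in> F \<union> G \<rightarrow> Fpow X"
  shows "hat_val (F \<union> G) f P \<le> hat X F + hat X G"
proof -
  let ?Q = "\<Union>g\<in>G - F. P g" and ?R = "\<Union>g\<in>F - {f}. P g"
  have fin: "finite F" "finite G" using F G by (auto simp: Fpow_iff)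
  have Q: "?Q \<in> Fpow X" and R: "?R \<in> Fpow X"
    using fin P by (auto intro!: UN_in_Fpow)
  have *: "k ?Q \<le> hat X G + (\<Sum>g\<in>G - F. g (P g))" if "k \<in> F" "k \<in> G" for k
  proof -
    have "(\<lambda>g. if g \<in> G - F then P g else {}) \<in> G \<rightarrow> Fpow X"
      using P by (auto simp: Pi_iff Fpow_iff)
    from hat_ge[OF G \<open>k \<in> G\<close> this] show ?thesis
      using hat_val_extend[OF G, of "G - F" k P] that by fastforce
  qed
  have split: "F \<union> G - {f} = (F - {f}) \<union> (G - F)" using f by auto
  have "(\<Sum>g\<in>F \<union> G - {f}. g (P g)) = (\<Sum>g\<in>F - {f}. g (P g)) + (\<Sum>g\<in>G - F. g (P g))"
    unfolding split by (rule sum.union_disjoint) (use fin in auto)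
  then have val: "hat_val (F \<union> G) f P = f (?R \<union> ?Q) - (\<Sum>g\<in>F - {f}. g (P g)) - (\<Sum>g\<in>G - F. g (P g))"
    unfolding hat_val_def split by (simp add: UN_Un)
  show ?thesis
  proof (cases "f \<in> G")
    case True
    have "f (?R \<union> ?Q) \<le> f ?R + f ?Q" by (rule adm_union[OF Fpow_E_adm[OF F f] R Q])
    moreover have "hat_val F f P \<le> hat X F" using F f P by (intro hat_ge) auto
    ultimately show ?thesis using *[OF f True] val by (simp add: hat_val_def)
  next
    case False
    then have hf: "h \<noteq> f" using h by auto
    \<comment> \<open>\<open>h\<close> takes over the sets of all functions in \<open>G - F\<close>.
      This costs at most \<open>h ?Q\<close> more, which the bound from \<open>G\<close>
      controls.\<close>
    let ?P = "P(h := P h \<union> ?Q)"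
    have "hat_val F f ?P \<le> hat X F"
      by (rule hat_ge[OF F f]) (use P Q h in \<open>auto simp: Pi_iff intro: Fpow_Un\<close>)
    moreover have "(\<Union>g\<in>F - {f}. ?P g) = ?R \<union> ?Q" using h hf by (auto split: if_splits)
    moreover have "(\<Sum>g\<in>F - {f}. g (?P g)) = h (P h \<union> ?Q) + (\<Sum>g\<in>F - {f} - {h}. g (P g))"
      using h hf fin by (subst sum.remove[of _ h]) auto
    moreover have "(\<Sum>g\<in>F - {f}. g (P g)) = h (P h) + (\<Sum>g\<in>F - {f} - {h}. g (P g))"
      using h hf fin by (subst sum.remove[of _ h]) auto
    moreover have "h (P h \<union> ?Q) \<le> h (P h) + h ?Q"
      using P h by (intro adm_union[OF Fpow_E_adm[OF F h(1)] _ Q]) auto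
    ultimately show ?thesis using *[OF h] val by (simp add: hat_val_def)
  qed
qed

lemma hat_union:
  assumes F: "F \<in> Fpow (E X \<delta>)" and G: "G \<in> Fpow (E X \<delta>)" and "F \<inter> G \<noteq> {}"
  shows "hat X (F \<union> G) \<le> hat X F + hat X G"
proof (rule hat_le)
  obtain h where h: "h \<in> F" "h \<in> G" using assms by blast
  fix f P assume "f \<in> F \<union> G" and P: "P \<in> F \<union> G \<rightarrow> Fpow X"
  then show "hat_val (F \<union> G) f P \<le> hat X F + hat X G"
    using hat_val_union[OF F G h, of f P] hat_val_union[OF G F h(2,1), of f P] by (auto simp: Un_commute)
qed (use assms in \<open>auto simp: Fpow_iff\<close>)

lemma hat_pair_ge:
  assumes "f \<in> E X \<delta>" "g \<in> E X \<delta>" "A \<in> Fpow X"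
  shows "f A - g A \<le> hat X {f, g}"
proof (cases "f = g")
  case False
  then have "hat_val {f, g} f (\<lambda>_. A) = f A - g A" by (simp add: hat_val_def)
  then show ?thesis using hat_ge[of "{f, g}" f "\<lambda>_. A"] assms by (simp add: Fpow_iff)
qed (use hat_nonneg[of "{f, g}"] assms in \<open>simp add: Fpow_iff\<close>)

text \<open>For two functions and \<open>k = f\<close>, \<open>hat_val\<close> is the difference
  \<open>f A - g A\<close> at \<open>A = P g\<close>. With \<open>hat_pair_ge\<close>, the metric
  induced by \<open>hat\<close> is thus the supremum distance.\<close>

lemma hat_pair_le:
  assumes "f \<in> E X \<delta>" "g \<in> E X \<delta>" and le: "\<And>A. A \<in> Fpow X \<Longrightarrow> \<bar>f A - g A\<bar> \<le> c"
  shows "hat X {f, g} \<le> c"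
proof (rule hat_le)
  fix k P assume k: "k \<in> {f, g}" and P: "P \<in> {f, g} \<rightarrow> Fpow X"
  have "0 \<le> c" using le[of "{}"] by (simp add: Fpow_iff)
  then show "hat_val {f, g} k P \<le> c"
    using k le[of "P f"] le[of "P g"] P adm_empty[OF E_adm[OF d assms(1)]] adm_empty[OF E_adm[OF d assms(2)]]
    by (cases "f = g") (auto simp: hat_val_def insert_Diff_if abs_le_iff)
qed (use assms in \<open>auto simp: Fpow_iff\<close>)

lemma hat_diversity: "diversity (E X \<delta>) (hat X)"
proof (rule diversityI)
  fix F assume F: "F \<in> Fpow (E X \<delta>)"
  show "hat X F = 0 \<longleftrightarrow> card F \<le> 1"
  proof
    assume 0: "hat X F = 0"
    show "card F \<le> 1"
    proof (rule ccontr)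
      assume "\<not> card F \<le> 1"
      then obtain f g where fg: "f \<in> F" "g \<in> F" "f \<noteq> g"
        using F card_le_Suc0_iff_eq[of F] by (auto simp: Fpow_iff)
      have E: "f \<in> E X \<delta>" "g \<in> E X \<delta>" using F fg by (auto simp: Fpow_iff)
      have "hat X {f, g} \<le> 0" "hat X {g, f} \<le> 0" using hat_mono[OF F, of "{f, g}"] fg 0 by (auto simp: insert_commute)
      then have "f A = g A" if "A \<in> Fpow X" for A
        using hat_pair_ge[OF E that] hat_pair_ge[OF E(2,1) that] by simp
      then show False using E_eqI[OF d E] fg by blast
    qed
  qed (simp add: hat_alt)
qed (use hat_nonneg hat_mono hat_union in auto)

text \<open>The point \<open>f\<close> of \<open>E X \<delta>\<close> lies over the embedded copy of
  \<open>X\<close> exactly as \<open>f\<close> prescribes, so one-point extensions are realized. The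
  upper bound is a star estimate with centre \<open>A\<close>.\<close>

lemma hat_insert_kappa:
  assumes f: "f \<in> E X \<delta>" and A: "A \<in> Fpow X"
  shows "hat X (insert f (kappa X \<delta> ` A)) = f A"
proof -
  let ?\<kappa> = "kappa X \<delta>"
  let ?F = "insert f (?\<kappa> ` A)"
  define b where "b = inv_into A ?\<kappa>"
  have finA: "finite A" and AX: "A \<subseteq> X" using A by (auto simp: Fpow_iff)
  have inj: "inj_on ?\<kappa> A" using inj_on_kappa[OF d] AX inj_on_subset by blast
  have b: "b (?\<kappa> a) = a" if "a \<in> A" for a using inj that by (simp add: b_def)
  have adm: "adm X \<delta> f" by (rule E_adm[OF d f])
  have F: "?F \<in> Fpow (E X \<delta>)" using f kappa_in_E[OF d] AX finA by (auto simp: Fpow_iff)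
  have \<kappa>_val: "g B = \<delta> (insert (b g) B)" if "g \<in> ?\<kappa> ` A" "B \<in> Fpow X" for g B
    using that b by (auto simp: kappa_def)
  show ?thesis
  proof (rule antisym)
    show "hat X ?F \<le> f A"
    proof (rule hat_le[OF F])
      fix k P assume k: "k \<in> ?F" and P: "P \<in> ?F \<rightarrow> Fpow X"
      show "hat_val ?F k P \<le> f A"
      proof (cases "k = f")
        case True
        have "f (\<Union>g\<in>?F - {f}. P g) \<le> f A + (\<Sum>g\<in>?F - {f}. \<delta> (insert (b g) (P g)))"
          by (rule compatible_star_Union[OF adm_compatible[OF adm]]) (use A P finA b in auto)
        also have "(\<Sum>g\<in>?F - {f}. \<delta> (insert (b g) (P g))) = (\<Sum>g\<in>?F - {f}. g (P g))"
          by (rule sum.cong) (use \<kappa>_val P in \<open>auto simp: Pi_iff\<close>)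
        finally show ?thesis using True by (simp add: hat_val_def)
      next
        case False
        then obtain a where a: "a \<in> A" "k = ?\<kappa> a" using k by auto
        \<comment> \<open>When \<open>k\<close> is the distance function of a point \<open>a\<close>
          of \<open>A\<close>, the set \<open>P f\<close> is joined to \<open>A\<close> at cost at
          most \<open>f A + f (P f)\<close>, and every remaining \<open>P g\<close> is hung on its
          point \<open>b g\<close> of \<open>A\<close>.\<close>
        let ?R = "?\<kappa> ` A - {k, f}"
        have Pf: "P f \<in> Fpow X" using P by auto
        have split: "?F - {k} = insert f ?R" using False by auto
        have U: "(\<Union>g\<in>?F - {k}. P g) \<in> Fpow X"
          using P finA by (intro UN_in_Fpow) auto
        have "k (\<Union>g\<in>?F - {k}. P g) = \<delta> (insert a (P f \<union> (\<Union>g\<in>?R. P g)))"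
          using \<kappa>_val[OF _ U, of k] a b[OF a(1)] unfolding split UN_insert by (metis imageI)
        also have "\<dots> \<le> \<delta> ((A \<union> P f) \<union> (\<Union>g\<in>?R. P g))"
          by (rule diversity_mono[OF d]) (use a A Pf P in \<open>auto simp: Fpow_iff Pi_iff\<close>)
        also have "\<dots> \<le> \<delta> (A \<union> P f) + (\<Sum>g\<in>?R. \<delta> (insert (b g) (P g)))"
          by (rule compatible_star[OF diversity_compatible[OF d]])
            (use finA A Pf P b in \<open>auto intro: Fpow_Un simp: Pi_iff\<close>)
        also have "(\<Sum>g\<in>?R. \<delta> (insert (b g) (P g))) = (\<Sum>g\<in>?R. g (P g))"
          by (rule sum.cong) (use \<kappa>_val P in \<open>auto simp: Pi_iff\<close>)
        also have "\<delta> (A \<union> P f) \<le> f A + f (P f)" by (rule adm_ge[OF adm A Pf])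
        finally show ?thesis using finA unfolding hat_val_def split by simp
      qed
    qed simp
    \<comment> \<open>Giving each point's distance function that point as its set makes all
      subtracted terms 0 while the union recovers \<open>A\<close>. If \<open>f\<close> is itself
      one of these functions, its point is missing from the union, but then
      \<open>f (P f) = 0\<close>.\<close>
    define P where "P g = (if g \<in> ?\<kappa> ` A then {b g} else {})" for g
    have P: "P \<in> ?F \<rightarrow> Fpow X" using b AX by (auto simp: P_def Fpow_iff)
    have zero: "(\<Sum>g\<in>?F - {f}. g (P g)) = 0"
    proof (rule sum.neutral, rule ballI)
      fix g assume "g \<in> ?F - {f}"
      then obtain a where "a \<in> A" "g = ?\<kappa> a" by auto
      then show "g (P g) = 0" using b AX diversity_singleton[OF d, of a]
        by (auto simp: P_def kappa_def Fpow_iff)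
    qed
    have Pf: "f (P f) = 0"
      using b AX diversity_singleton[OF d] adm_empty[OF adm]
      by (auto simp: P_def kappa_def Fpow_iff)
    have U: "(\<Union>g\<in>?F - {f}. P g) \<in> Fpow X" "P f \<in> Fpow X"
      using P finA by (auto intro!: UN_in_Fpow)
    have "A \<subseteq> (\<Union>g\<in>?F - {f}. P g) \<union> P f"
    proof
      fix a assume "a \<in> A"
      then have "a \<in> P (?\<kappa> a)" "?\<kappa> a \<in> ?F" using b by (auto simp: P_def)
      then show "a \<in> (\<Union>g\<in>?F - {f}. P g) \<union> P f" by blast
    qed
    then have "f A \<le> f ((\<Union>g\<in>?F - {f}. P g) \<union> P f)"
      using U by (intro adm_mono[OF adm] Fpow_Un)
    also have "\<dots> \<le> f (\<Union>g\<in>?F - {f}. P g)" using adm_union[OF adm U] Pf by simp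
    also have "\<dots> = hat_val ?F f P" using zero by (simp add: hat_val_def)
    also have "\<dots> \<le> hat X ?F" using P by (intro hat_ge[OF F]) auto
    finally show "f A \<le> hat X ?F" .
  qed
qed

lemma hat_kappa:
  assumes A: "A \<in> Fpow X"
  shows "hat X (kappa X \<delta> ` A) = \<delta> A"
proof (cases "A = {}")
  case False
  then obtain a where a: "a \<in> A" by blast
  have "insert (kappa X \<delta> a) (kappa X \<delta> ` A) = kappa X \<delta> ` A" using a by auto
  moreover have "kappa X \<delta> a A = \<delta> A" using a A by (simp add: kappa_def insert_absorb)
  ultimately show ?thesis using hat_insert_kappa[OF kappa_in_E[OF d] A, of a] a A
    by (auto simp: Fpow_iff)
qed (simp add: hat_alt diversity_empty[OF d])

end

section \<open>Finitely supported functions\<close>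

definition ext_sum :: "('a set \<Rightarrow> real) \<Rightarrow> ('a set \<Rightarrow> real) \<Rightarrow> 'a set \<Rightarrow> ('a \<Rightarrow> 'a set) \<Rightarrow> real" where
  "ext_sum \<delta> f B P = f B + (\<Sum>b\<in>B. \<delta> (insert b (P b)))"

context
  fixes X :: "'a set" and \<delta> :: "'a set \<Rightarrow> real" and S :: "'a set" and f :: "'a set \<Rightarrow> real"
  assumes d: "diversity X \<delta>" and S: "finite S" "S \<noteq> {}" "S \<subseteq> X" and f: "adm S \<delta> f"
begin

lemma ext_sum_nonneg:
  assumes "B \<in> Fpow S" "(\<Union>b\<in>B. P b) \<in> Fpow X"
  shows "0 \<le> ext_sum \<delta> f B P"
proof -
  have "0 \<le> \<delta> (insert b (P b))" if "b \<in> B" for b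
    by (rule diversity_nonneg[OF d])
      (use assms S that finite_subset[of "P b" "\<Union>b\<in>B. P b"] in \<open>auto simp: Fpow_iff\<close>)
  then show ?thesis
    unfolding ext_sum_def using adm_nonneg[OF f assms(1)] by (simp add: sum_nonneg)
qed

lemma support_ext_Inf:
  "A \<in> Fpow X \<Longrightarrow>
    support_ext X \<delta> S f A = Inf {ext_sum \<delta> f B P | B P. B \<in> Fpow S \<and> (\<Union>b\<in>B. P b) = A}"
  by (simp add: support_ext_def ext_sum_def)

lemma support_ext_le:
  assumes A: "A \<in> Fpow X" and B: "B \<in> Fpow S" "(\<Union>b\<in>B. P b) = A"
  shows "support_ext X \<delta> S f A \<le> ext_sum \<delta> f B P"
  unfolding support_ext_Inf[OF A]
proof (rule cInf_lower)
  show "bdd_below {ext_sum \<delta> f B P | B P. B \<in> Fpow S \<and> (\<Union>b\<in>B. P b) = A}"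
    by (rule bdd_belowI[of _ 0]) (use ext_sum_nonneg A in auto)
qed (use B in auto)

lemma support_ext_set_nonempty: "{ext_sum \<delta> f B P | B P. B \<in> Fpow S \<and> (\<Union>b\<in>B. P b) = A} \<noteq> {}"
proof -
  obtain s where "s \<in> S" using S by blast
  then have "{s} \<in> Fpow S \<and> (\<Union>b\<in>{s}. A) = A" by (simp add: Fpow_iff)
  then show ?thesis by blast
qed

lemma support_ext_ge:
  assumes A: "A \<in> Fpow X" and "\<And>B P. B \<in> Fpow S \<Longrightarrow> (\<Union>b\<in>B. P b) = A \<Longrightarrow> c \<le> ext_sum \<delta> f B P"
  shows "c \<le> support_ext X \<delta> S f A"
  unfolding support_ext_Inf[OF A]
  by (rule cInf_greatest[OF support_ext_set_nonempty]) (use assms in auto)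

text \<open>The universal property: \<open>support_ext X \<delta> S f\<close> is the largest
  compatible function on \<open>X\<close> that is at most \<open>f\<close> on \<open>S\<close>. The
  constant \<open>c\<close> makes it usable for approximate comparisons.\<close>

lemma le_support_ext:
  assumes k: "compatible X \<delta> k" and le: "\<And>B. B \<in> Fpow S \<Longrightarrow> k B \<le> f B + c" and A: "A \<in> Fpow X"
  shows "k A \<le> support_ext X \<delta> S f A + c"
proof -
  have "k A - c \<le> support_ext X \<delta> S f A"
  proof (rule support_ext_ge[OF A])
    fix B P assume B: "B \<in> Fpow S" and PA: "(\<Union>b\<in>B. P b) = A"
    have "k (\<Union>b\<in>B. P b) \<le> k B + (\<Sum>b\<in>B. \<delta> (insert b (P b)))"
    proof (rule compatible_star_Union[OF k])
      fix b assume "b \<in> B"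
      then have "P b \<subseteq> A" using PA by auto
      then show "P b \<in> Fpow X" using A by (auto simp: Fpow_iff intro: finite_subset)
    qed (use B S in \<open>auto simp: Fpow_iff\<close>)
    then show "k A - c \<le> ext_sum \<delta> f B P"
      using le[OF B] PA by (simp add: ext_sum_def)
  qed
  then show ?thesis by simp
qed

lemma support_ext_le_on:
  assumes A: "A \<in> Fpow S"
  shows "support_ext X \<delta> S f A \<le> f A"
proof -
  have "(\<Sum>b\<in>A. \<delta> (insert b {b})) = 0"
    using A S diversity_singleton[OF d] by (auto simp: Fpow_iff intro!: sum.neutral)
  then have "ext_sum \<delta> f A (\<lambda>b. {b}) = f A" by (simp add: ext_sum_def)
  with support_ext_le[of A A "\<lambda>b. {b}"] show ?thesis
    using A S by (auto simp: Fpow_iff)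
qed

text \<open>For \<open>A \<subseteq> S\<close> all sets of a decomposition lie in \<open>S\<close>,
  so the star estimate for \<open>f\<close> itself shows that no decomposition is cheaper than
  \<open>f A\<close>.\<close>

lemma support_ext_on:
  assumes A: "A \<in> Fpow S"
  shows "support_ext X \<delta> S f A = f A"
proof (rule antisym[OF support_ext_le_on[OF A]])
  have AX: "A \<in> Fpow X" using A S by (auto simp: Fpow_iff)
  show "f A \<le> support_ext X \<delta> S f A"
  proof (rule support_ext_ge[OF AX])
    fix B P assume B: "B \<in> Fpow S" and PA: "(\<Union>b\<in>B. P b) = A"
    have "f (\<Union>b\<in>B. P b) \<le> f B + (\<Sum>b\<in>B. \<delta> (insert b (P b)))"
      by (rule compatible_star_Union[OF adm_compatible[OF f]])
        (use A B PA in \<open>auto simp: Fpow_iff intro: finite_subset\<close>)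
    then show "f A \<le> ext_sum \<delta> f B P" using PA by (simp add: ext_sum_def)
  qed
qed

lemma ext_sum_mono:
  assumes A: "A \<in> Fpow X" and B: "B \<in> Fpow S" "(\<Union>b\<in>B. P b) = A"
  shows "ext_sum \<delta> f B (\<lambda>b. P b \<inter> A') \<le> ext_sum \<delta> f B P"
  unfolding ext_sum_def
proof (intro add_left_mono sum_mono)
  fix b assume b: "b \<in> B"
  then have "P b \<subseteq> A" using B by auto
  then have "insert b (P b) \<in> Fpow X" using A B S b by (auto simp: Fpow_iff intro: finite_subset)
  then show "\<delta> (insert b (P b \<inter> A')) \<le> \<delta> (insert b (P b))"
    by (rule diversity_mono[OF d]) auto
qed

lemma ext_sum_Un:
  assumes A: "A \<in> Fpow X" "A' \<in> Fpow X" and B: "B \<in> Fpow S" "(\<Union>b\<in>B. P b) = A"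
    and B': "B' \<in> Fpow S" "(\<Union>b\<in>B'. P' b) = A'"
  shows "\<delta> (A \<union> A') \<le> ext_sum \<delta> f B P + ext_sum \<delta> f B' P'"
    and "support_ext X \<delta> S f (A \<union> A') \<le> ext_sum \<delta> f B P + ext_sum \<delta> f B' P'"
proof -
  \<comment> \<open>Padding with empty sets puts both decompositions on the index set
    \<open>B \<union> B'\<close>. The added terms are values of singletons, hence 0, and two sets
    hung on the same \<open>b\<close> merge subadditively.\<close>
  define Q where "Q b = (if b \<in> B then P b else {})" for b
  define Q' where "Q' b = (if b \<in> B' then P' b else {})" for b
  have fin: "finite (B \<union> B')" using B B' by (auto simp: Fpow_iff)
  have BS: "B \<union> B' \<in> Fpow S" "B \<union> B' \<in> Fpow X" using B B' S by (auto simp: Fpow_iff)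
  have QA: "Q b \<subseteq> A" "Q' b \<subseteq> A'" for b using B B' by (auto simp: Q_def Q'_def)
  have Qf: "Q b \<in> Fpow X" "Q' b \<in> Fpow X" for b
    using A finite_subset[of "Q b" A] finite_subset[of "Q' b" A'] QA[of b] by (auto simp: Fpow_iff)
  have U: "(\<Union>b\<in>B \<union> B'. Q b \<union> Q' b) = A \<union> A'"
    using B(2) B'(2) unfolding Q_def Q'_def by (fastforce split: if_splits)
  have "(\<Sum>b\<in>B \<union> B'. \<delta> (insert b (Q b \<union> Q' b)))
      \<le> (\<Sum>b\<in>B \<union> B'. \<delta> (insert b (Q b)) + \<delta> (insert b (Q' b)))"
  proof (rule sum_mono)
    fix b assume b: "b \<in> B \<union> B'"
    then have "\<delta> (insert b (Q b) \<union> insert b (Q' b)) \<le> \<delta> (insert b (Q b)) + \<delta> (insert b (Q' b))"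
      by (intro diversity_union[OF d]) (use Qf BS in \<open>auto simp: Fpow_iff\<close>)
    then show "\<delta> (insert b (Q b \<union> Q' b)) \<le> \<delta> (insert b (Q b)) + \<delta> (insert b (Q' b))" by simp
  qed
  also have "\<dots> = (\<Sum>b\<in>B \<union> B'. \<delta> (insert b (Q b))) + (\<Sum>b\<in>B \<union> B'. \<delta> (insert b (Q' b)))"
    by (rule sum.distrib)
  also have "(\<Sum>b\<in>B \<union> B'. \<delta> (insert b (Q b))) = (\<Sum>b\<in>B. \<delta> (insert b (P b)))"
    by (rule sum.mono_neutral_cong_right)
      (use fin BS diversity_singleton[OF d] in \<open>auto simp: Q_def Fpow_iff\<close>)
  also have "(\<Sum>b\<in>B \<union> B'. \<delta> (insert b (Q' b))) = (\<Sum>b\<in>B'. \<delta> (insert b (P' b)))"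
    by (rule sum.mono_neutral_cong_right)
      (use fin BS diversity_singleton[OF d] in \<open>auto simp: Q'_def Fpow_iff\<close>)
  finally have sum: "(\<Sum>b\<in>B \<union> B'. \<delta> (insert b (Q b \<union> Q' b)))
      \<le> (\<Sum>b\<in>B. \<delta> (insert b (P b))) + (\<Sum>b\<in>B'. \<delta> (insert b (P' b)))" .
  have "\<delta> (\<Union>b\<in>B \<union> B'. Q b \<union> Q' b) \<le> \<delta> (B \<union> B') + (\<Sum>b\<in>B \<union> B'. \<delta> (insert b (Q b \<union> Q' b)))"
    by (rule compatible_star_Union[OF diversity_compatible[OF d]]) (use fin BS Qf in \<open>auto intro: Fpow_Un\<close>)
  with sum adm_ge[OF f B(1) B'(1)] show "\<delta> (A \<union> A') \<le> ext_sum \<delta> f B P + ext_sum \<delta> f B' P'"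
    unfolding U ext_sum_def by linarith
  have "support_ext X \<delta> S f (A \<union> A') \<le> ext_sum \<delta> f (B \<union> B') (\<lambda>b. Q b \<union> Q' b)"
    by (rule support_ext_le[OF Fpow_Un[OF A] BS(1) U])
  with sum adm_union[OF f B(1) B'(1)]
  show "support_ext X \<delta> S f (A \<union> A') \<le> ext_sum \<delta> f B P + ext_sum \<delta> f B' P'"
    unfolding ext_sum_def by linarith
qed

lemma ext_sum_insert:
  assumes A: "A \<in> Fpow X" and C: "C \<in> Fpow X" "A \<inter> C \<noteq> {}"
    and B: "B \<in> Fpow S" "(\<Union>b\<in>B. P b) = A"
  shows "support_ext X \<delta> S f (A \<union> C) \<le> ext_sum \<delta> f B P + \<delta> C"
proof -
  \<comment> \<open>One set of the decomposition already meets \<open>C\<close> and can absorb it at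
    cost \<open>\<delta> C\<close>.\<close>
  obtain b where b: "b \<in> B" "P b \<inter> C \<noteq> {}" using B C by auto
  have Pb: "P b \<in> Fpow X" using A B b by (auto simp: Fpow_iff intro: finite_subset)
  let ?P = "P(b := P b \<union> C)"
  have "finite B" using B by (simp add: Fpow_iff)
  have "support_ext X \<delta> S f (A \<union> C) \<le> ext_sum \<delta> f B ?P"
    by (rule support_ext_le[OF Fpow_Un[OF A C(1)] B(1)]) (use B b in \<open>auto split: if_splits\<close>)
  also have "\<dots> = f B + (\<delta> (insert b (P b \<union> C)) + (\<Sum>b\<in>B - {b}. \<delta> (insert b (P b))))"
    unfolding ext_sum_def using b \<open>finite B\<close> by (subst sum.remove[of _ b]) auto
  also have "\<delta> (insert b (P b) \<union> C) \<le> \<delta> (insert b (P b)) + \<delta> C"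
    by (rule diversity_union[OF d]) (use b Pb C B S in \<open>auto simp: Fpow_iff\<close>)
  then have "f B + (\<delta> (insert b (P b \<union> C)) + (\<Sum>b\<in>B - {b}. \<delta> (insert b (P b))))
      \<le> f B + (\<delta> (insert b (P b)) + (\<Sum>b\<in>B - {b}. \<delta> (insert b (P b)))) + \<delta> C" by simp
  also have "\<dots> = ext_sum \<delta> f B P + \<delta> C"
    unfolding ext_sum_def using b \<open>finite B\<close> by (subst sum.remove[of B b]) auto
  finally show ?thesis .
qed

lemma support_ext_adm: "adm X \<delta> (support_ext X \<delta> S f)"
  unfolding adm_def compatible_def
proof (intro conjI allI ballI impI)
  let ?g = "support_ext X \<delta> S f"
  show "?g {} = 0"
    using support_ext_on[of "{}"] adm_empty[OF f] by (simp add: Fpow_iff)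
  { fix A A' assume A: "A \<in> Fpow X" and A': "A' \<subseteq> A"
    show "?g A' \<le> ?g A"
    proof (rule support_ext_ge[OF A])
      fix B P assume B: "B \<in> Fpow S" "(\<Union>b\<in>B. P b) = A"
      have "?g A' \<le> ext_sum \<delta> f B (\<lambda>b. P b \<inter> A')"
        by (rule support_ext_le) (use A A' B in \<open>auto simp: Fpow_iff intro: finite_subset\<close>)
      also have "\<dots> \<le> ext_sum \<delta> f B P" by (rule ext_sum_mono[OF A B])
      finally show "?g A' \<le> ext_sum \<delta> f B P" .
    qed }
  { fix A C assume *: "A \<in> Fpow X" "C \<in> Fpow X" "A \<inter> C \<noteq> {}"
    have "?g (A \<union> C) - \<delta> C \<le> ?g A"
    proof (rule support_ext_ge)
      fix B P assume "B \<in> Fpow S" "(\<Union>b\<in>B. P b) = A"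
      from ext_sum_insert[OF * this] show "?g (A \<union> C) - \<delta> C \<le> ext_sum \<delta> f B P" by simp
    qed (use * in auto)
    then show "?g (A \<union> C) \<le> ?g A + \<delta> C" by simp }
  fix A A' assume A: "A \<in> Fpow X" "A' \<in> Fpow X"
  \<comment> \<open>A bound for all pairs of decompositions passes to the sum of the two infima,
    taken one after the other.\<close>
  { fix c assume c: "\<And>B P B' P'. B \<in> Fpow S \<Longrightarrow> (\<Union>b\<in>B. P b) = A \<Longrightarrow> B' \<in> Fpow S \<Longrightarrow> (\<Union>b\<in>B'. P' b) = A' \<Longrightarrow>
        c \<le> ext_sum \<delta> f B P + ext_sum \<delta> f B' P'"
    have "c - ?g A' \<le> ?g A"
    proof (rule support_ext_ge[OF A(1)])
      fix B P assume B: "B \<in> Fpow S" "(\<Union>b\<in>B. P b) = A"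
      have "c - ext_sum \<delta> f B P \<le> ?g A'"
      proof (rule support_ext_ge[OF A(2)])
        fix B' P' assume B': "B' \<in> Fpow S" "(\<Union>b\<in>B'. P' b) = A'"
        show "c - ext_sum \<delta> f B P \<le> ext_sum \<delta> f B' P'" using c[OF B B'] by simp
      qed
      then show "c - ?g A' \<le> ext_sum \<delta> f B P" by simp
    qed
    then have "c \<le> ?g A + ?g A'" by simp }
  note le = this
  show "\<delta> (A \<union> A') \<le> ?g A + ?g A'" by (rule le) (rule ext_sum_Un(1)[OF A])
  show "?g (A \<union> A') \<le> ?g A + ?g A'" by (rule le) (rule ext_sum_Un(2)[OF A])
qed

lemma support_ext_in_E: "support_ext X \<delta> S f \<in> E X \<delta>"
  using support_ext_adm by (simp add: E_iff[OF d] support_ext_def)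

end

lemma E_finE:
  assumes d: "diversity X \<delta>" and g: "g \<in> E_fin X \<delta>"
  obtains S f where "finite S" "S \<noteq> {}" "S \<subseteq> X" "f \<in> E S \<delta>" "adm S \<delta> f" "g = support_ext X \<delta> S f"
proof -
  obtain S f where Sf: "finite S" "S \<noteq> {}" "S \<subseteq> X" "f \<in> E S \<delta>" "g = support_ext X \<delta> S f"
    using g unfolding E_fin_def by blast
  show ?thesis using that[OF Sf(1-4) E_adm[OF diversity_subset[OF d Sf(3)] Sf(4)] Sf(5)] .
qed

lemma support_ext_in_E_fin:
  assumes d: "diversity X \<delta>" and S: "finite S" "S \<noteq> {}" "S \<subseteq> X" and f: "f \<in> E S \<delta>"
  shows "support_ext X \<delta> S f \<in> E_fin X \<delta>"
  using support_ext_in_E[OF d S E_adm[OF diversity_subset[OF d S(3)] f]] S f unfolding E_fin_def by blast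

text \<open>The support is \<open>{x}\<close>: the extension is admissible and vanishes at
  \<open>x\<close>, which already determines it.\<close>

lemma kappa_in_E_fin:
  assumes d: "diversity X \<delta>" and x: "x \<in> X"
  shows "kappa X \<delta> x \<in> E_fin X \<delta>"
proof -
  have S: "finite {x}" "{x} \<noteq> {}" "{x} \<subseteq> X" using x by auto
  have dS: "diversity {x} \<delta>" by (rule diversity_subset[OF d S(3)])
  define f where "f = kappa {x} \<delta> x"
  have f: "f \<in> E {x} \<delta>" unfolding f_def by (rule kappa_in_E[OF dS]) simp
  note adm = support_ext_adm[OF d S E_adm[OF dS f]]
  have "support_ext X \<delta> {x} f {x} = 0"
    using support_ext_on[OF d S E_adm[OF dS f], of "{x}"] diversity_singleton[OF d x]
    by (simp add: f_def kappa_def Fpow_iff)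
  then have "support_ext X \<delta> {x} f A = kappa X \<delta> x A" if "A \<in> Fpow X" for A
    using adm_eq_kappa[OF d adm x _ that] that by (simp add: kappa_def)
  then have "support_ext X \<delta> {x} f = kappa X \<delta> x"
    by (intro extensionalityI[of _ "Fpow X"]) (auto simp: support_ext_def kappa_def)
  then show ?thesis using support_ext_in_E_fin[OF d S f] by simp
qed

lemma E_fin_subset: "E_fin X \<delta> \<subseteq> E X \<delta>"
  by (auto simp: E_fin_def)

section \<open>Separability of the set of finitely supported functions\<close>

definition separable_div :: "'a set \<Rightarrow> ('a set \<Rightarrow> real) \<Rightarrow> bool" where
  "separable_div X \<delta> \<longleftrightarrow> (\<exists>D. countable D \<and> D \<subseteq> X \<and> (\<forall>x\<in>X. \<forall>e>0. \<exists>y\<in>D. \<delta> {x, y} < e))"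

text \<open>The original extension agrees with \<open>f'\<close> on the moved support, so it lies
  below the new one. Conversely, for \<open>B \<subseteq> S\<close> pass to the image of
  \<open>B\<close> under \<open>h\<close> and back: both extensions change by at most
  \<open>card S * \<eta>\<close>, whence the factor 2.\<close>

lemma support_ext_move:
  fixes \<eta> :: real
  assumes d: "diversity X \<delta>" and S: "finite S" "S \<noteq> {}" "S \<subseteq> X" and f: "adm S \<delta> f"
    and h: "h ` S \<subseteq> X" "\<And>s. s \<in> S \<Longrightarrow> \<delta> {s, h s} \<le> \<eta>"
    and f': "\<And>B. B \<in> Fpow (h ` S) \<Longrightarrow> f' B = support_ext X \<delta> S f B" "adm (h ` S) \<delta> f'"
    and A: "A \<in> Fpow X"
  shows "\<bar>support_ext X \<delta> (h ` S) f' A - support_ext X \<delta> S f A\<bar> \<le> 2 * card S * \<eta>"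
proof -
  let ?g = "support_ext X \<delta> S f" and ?g' = "support_ext X \<delta> (h ` S) f'"
  have hS: "finite (h ` S)" "h ` S \<noteq> {}" "h ` S \<subseteq> X" using S h by auto
  note g = adm_compatible[OF support_ext_adm[OF d S f]]
  note g' = adm_compatible[OF support_ext_adm[OF d hS f'(2)]]
  have "0 \<le> \<eta>"
  proof -
    obtain s where "s \<in> S" using S by blast
    then show ?thesis using h(2)[of s] diversity_nonneg[OF d, of "{s, h s}"] S h by (force simp: Fpow_iff)
  qed
  have "?g A \<le> ?g' A + 0"
    by (rule le_support_ext[OF d hS f'(2) g _ A]) (simp add: f')
  moreover have "?g' A \<le> ?g A + 2 * card S * \<eta>"
  proof (rule le_support_ext[OF d S f g' _ A])
    fix B assume B: "B \<in> Fpow S"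
    then have BX: "B \<in> Fpow X" "h ` B \<subseteq> X" "h ` B \<in> Fpow (h ` S)"
      using S(3) subset_trans[OF image_mono h(1), of B] by (auto simp: Fpow_iff)
    have "(\<Sum>a\<in>B. \<delta> {a, h a}) \<le> (\<Sum>a\<in>B. \<eta>)"
      by (rule sum_mono) (use B h in \<open>auto simp: Fpow_iff\<close>)
    also have "\<dots> \<le> card S * \<eta>"
      using card_mono[of S B] B S \<open>0 \<le> \<eta>\<close> by (auto simp: Fpow_iff intro: mult_right_mono)
    finally have "\<bar>?g (h ` B) - ?g B\<bar> \<le> card S * \<eta>" "\<bar>?g' (h ` B) - ?g' B\<bar> \<le> card S * \<eta>"
      using compatible_lipschitz[OF g BX(1,2)] compatible_lipschitz[OF g' BX(1,2)] by linarith+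
    moreover have "?g B = f B" by (rule support_ext_on[OF d S f B])
    moreover have "?g' (h ` B) = ?g (h ` B)"
      using support_ext_on[OF d hS f'(2) BX(3)] f'(1)[OF BX(3)] by simp
    ultimately show "?g' B \<le> f B + 2 * card S * \<eta>" by simp
  qed
  ultimately show ?thesis using \<open>0 \<le> \<eta>\<close> by (simp add: abs_le_iff)
qed

text \<open>\<open>le_support_ext\<close> in both directions, each extension serving as the
  compatible function for the other.\<close>

lemma support_ext_sup_norm:
  assumes d: "diversity X \<delta>" and S: "finite S" "S \<noteq> {}" "S \<subseteq> X" and f: "adm S \<delta> f" "adm S \<delta> f'"
    and le: "\<And>B. B \<in> Fpow S \<Longrightarrow> \<bar>f B - f' B\<bar> \<le> c" and A: "A \<in> Fpow X"
  shows "\<bar>support_ext X \<delta> S f A - support_ext X \<delta> S f' A\<bar> \<le> c"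
proof -
  have *: "support_ext X \<delta> S k A \<le> support_ext X \<delta> S k' A + c"
    if k: "adm S \<delta> k" "adm S \<delta> k'" and *: "\<And>B. B \<in> Fpow S \<Longrightarrow> \<bar>k B - k' B\<bar> \<le> c" for k k'
  proof (rule le_support_ext[OF d S k(2) adm_compatible[OF support_ext_adm[OF d S k(1)]] _ A])
    fix B assume B: "B \<in> Fpow S"
    show "support_ext X \<delta> S k B \<le> k' B + c"
      using support_ext_on[OF d S k(1) B] *[OF B] by linarith
  qed
  show ?thesis using *[OF f le] *[OF f(2,1)] le by (simp add: abs_le_iff abs_minus_commute)
qed

text \<open>A code stands for a finite support in \<open>D\<close>, a precision \<open>n\<close>
  and, for each subset of the support, the integer part of the value times
  \<open>n + 1\<close>.\<close>

lemma countable_codes: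
  assumes "countable D"
  shows "countable (SIGMA S:Fpow D. (UNIV :: nat set) \<times> (Fpow S \<rightarrow>\<^sub>E (UNIV :: int set)))"
proof (rule countable_SIGMA)
  have "Fpow D = {S. finite S \<and> S \<subseteq> D}" by (auto simp: Fpow_def)
  then show "countable (Fpow D)" using countable_Collect_finite_subset[OF assms] by simp
  fix S assume "S \<in> Fpow D"
  then have "finite (Fpow S)" using finite_subset[of "Fpow S" "Pow S"] by (auto simp: Fpow_iff Fpow_def)
  then show "countable ((UNIV :: nat set) \<times> (Fpow S \<rightarrow>\<^sub>E (UNIV :: int set)))"
    by (intro countable_SIGMA countable_PiE) auto
qed

lemma floor_eq_imp_close:
  fixes x y :: real
  assumes "\<lfloor>x * real (Suc n)\<rfloor> = \<lfloor>y * real (Suc n)\<rfloor>"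
  shows "\<bar>x - y\<bar> \<le> inverse (real (Suc n))"
proof -
  have "\<bar>x * real (Suc n) - y * real (Suc n)\<bar> \<le> 1"
    using assms floor_correct[of "x * real (Suc n)"] floor_correct[of "y * real (Suc n)"] by linarith
  moreover have "x * real (Suc n) - y * real (Suc n) = (x - y) * real (Suc n)" by (simp only: left_diff_distrib)
  ultimately have "\<bar>x - y\<bar> * real (Suc n) \<le> 1" by (simp add: abs_mult)
  then show ?thesis by (simp add: field_simps)
qed

lemma separable_E_fin:
  assumes d: "diversity X \<delta>" and ne: "X \<noteq> {}" and sep: "separable_div X \<delta>"
  shows "separable_div (E_fin X \<delta>) (hat X)"
proof -
  obtain D where D: "countable D" "D \<subseteq> X" "\<And>x e. x \<in> X \<Longrightarrow> 0 < e \<Longrightarrow> \<exists>y\<in>D. \<delta> {x, y} < e"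
    using sep unfolding separable_div_def by metis
  define good where
    "good S n q f \<longleftrightarrow> f \<in> E S \<delta> \<and> (\<lambda>B\<in>Fpow S. \<lfloor>f B * real (Suc n)\<rfloor>) = q" for S n q f
  define pick where "pick = (\<lambda>(S, n, q). support_ext X \<delta> S (SOME f. good S n q f))"
  \<comment> \<open>The intersection keeps \<open>C\<close> inside \<open>E_fin X \<delta>\<close>
    even for codes that no function produces, where \<open>SOME\<close> in \<open>pick\<close> is
    arbitrary.\<close>
  define C where "C = pick ` (SIGMA S:Fpow D. UNIV \<times> (Fpow S \<rightarrow>\<^sub>E UNIV)) \<inter> E_fin X \<delta>"
  have "\<exists>y\<in>C. hat X {g, y} < e" if g: "g \<in> E_fin X \<delta>" and e: "0 < e" for g e
  proof -
    obtain S f where S: "finite S" "S \<noteq> {}" "S \<subseteq> X" and f: "adm S \<delta> f" and g_eq: "g = support_ext X \<delta> S f"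
      using E_finE[OF d g] by metis
    \<comment> \<open>Moving the support costs \<open>2 * card S * \<eta> = e / 4\<close> and
      rounding the values less than \<open>e / 4\<close>; the sum \<open>e / 2\<close> leaves room
      for the strict inequality.\<close>
    define \<eta> where "\<eta> = e / (8 * card S)"
    have "card S > 0" using S by (simp add: card_gt_0_iff)
    then have \<eta>: "0 < \<eta>" "2 * card S * \<eta> = e / 4" using e by (simp_all add: \<eta>_def)
    have "\<forall>s\<in>S. \<exists>t. t \<in> D \<and> \<delta> {s, t} < \<eta>" using D(3) S(3) \<eta>(1) by blast
    then obtain h where h: "\<And>s. s \<in> S \<Longrightarrow> h s \<in> D \<and> \<delta> {s, h s} < \<eta>" by metis
    have hS: "finite (h ` S)" "h ` S \<noteq> {}" "h ` S \<subseteq> X" using S h D(2) by auto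
    have hSD: "h ` S \<in> Fpow D" using S h by (auto simp: Fpow_iff)
    have dS: "diversity (h ` S) \<delta>" by (rule diversity_subset[OF d hS(3)])
    define f' where "f' = restrict g (Fpow (h ` S))"
    have f': "f' \<in> E (h ` S) \<delta>"
      unfolding f'_def g_eq by (intro restrict_in_E dS adm_subset[OF support_ext_adm[OF d S f]] hS)
    obtain n where n: "inverse (real (Suc n)) < e / 4" using reals_Archimedean[of "e / 4"] e by auto
    define q where "q = (\<lambda>B\<in>Fpow (h ` S). \<lfloor>f' B * real (Suc n)\<rfloor>)"
    define f'' where "f'' = (SOME f. good (h ` S) n q f)"
    have "good (h ` S) n q f''"
      unfolding f''_def by (rule someI[of _ f']) (unfold good_def q_def, intro conjI f' refl)
    then have f'': "f'' \<in> E (h ` S) \<delta>"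
      and code: "(\<lambda>B\<in>Fpow (h ` S). \<lfloor>f'' B * real (Suc n)\<rfloor>) = (\<lambda>B\<in>Fpow (h ` S). \<lfloor>f' B * real (Suc n)\<rfloor>)"
      unfolding good_def q_def by blast+
    have q: "\<lfloor>f'' B * real (Suc n)\<rfloor> = \<lfloor>f' B * real (Suc n)\<rfloor>" if "B \<in> Fpow (h ` S)" for B
      using fun_cong[OF code, of B] by (simp only: restrict_apply'[OF that])
    define g'' where "g'' = support_ext X \<delta> (h ` S) f''"
    have g'': "g'' \<in> E_fin X \<delta>" unfolding g''_def by (rule support_ext_in_E_fin[OF d hS f''])
    have "g'' = pick (h ` S, n, q)" by (simp add: g''_def pick_def f''_def)
    moreover have "(h ` S, n, q) \<in> (SIGMA S:Fpow D. UNIV \<times> (Fpow S \<rightarrow>\<^sub>E UNIV))"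
      using hSD by (auto simp: q_def)
    ultimately have "g'' \<in> C" using g'' by (auto simp: C_def)
    moreover have "hat X {g, g''} \<le> e / 4 + e / 4"
    proof (rule hat_pair_le[OF d ne])
      fix A assume A: "A \<in> Fpow X"
      have "\<bar>support_ext X \<delta> (h ` S) f' A - g A\<bar> \<le> e / 4"
        unfolding g_eq \<eta>(2)[symmetric]
        by (rule support_ext_move[OF d S f hS(3) _ _ E_adm[OF dS f'] A])
          (use h in \<open>auto simp: f'_def g_eq less_imp_le\<close>)
      moreover have "\<bar>g'' A - support_ext X \<delta> (h ` S) f' A\<bar> \<le> inverse (real (Suc n))"
        unfolding g''_def
        by (rule support_ext_sup_norm[OF d hS E_adm[OF dS f''] E_adm[OF dS f'] _ A])
          (rule floor_eq_imp_close, rule q)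
      ultimately show "\<bar>g A - g'' A\<bar> \<le> e / 4 + e / 4" using n by linarith
    qed (use g g'' E_fin_subset in auto)
    ultimately show ?thesis using e by (intro bexI[of _ g'']) auto
  qed
  moreover have "countable C" unfolding C_def using countable_codes[OF D(1)] by auto
  ultimately show ?thesis unfolding separable_div_def by (intro exI[of _ C]) (auto simp: C_def)
qed

section \<open>The stages and their direct limit\<close>

text \<open>The first components of the graph form \<open>fPow S\<close>, and \<open>S\<close> is
  recovered as its largest member.\<close>

lemma graph_on_inject:
  assumes "graph_on S f = graph_on T f'"
  shows "S = T" and "\<And>B. B \<in> Fpow (fset S) \<Longrightarrow> f B = f' B"
proof -
  have dom: "fst |`| graph_on R k = fPow R" for R :: "'a fset" and k
    unfolding graph_on_def by (simp add: fset.map_comp comp_def)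
  have "fPow S = fPow T" using dom[of S f] dom[of T f'] assms by simp
  then have "S |\<in>| fPow T" "T |\<in>| fPow S" by auto
  then show "S = T" by auto
  fix B assume "B \<in> Fpow (fset S)"
  then obtain B' where B': "B = fset B'" "B' |\<subseteq>| S"
    by (metis Fpow_iff Abs_fset_inverse mem_Collect_eq less_eq_fset.rep_eq)
  then have "(B', f B) |\<in>| graph_on S f" by (auto simp: graph_on_def)
  then have "(B', f B) |\<in>| graph_on T f'" using assms by simp
  then show "f B = f' B" using B' by (auto simp: graph_on_def)
qed

text \<open>The realizing point may lie in \<open>S\<close>, namely when \<open>f\<close> vanishes
  at a point of \<open>S\<close>. The set \<open>S\<close> is nonempty because it becomes the
  support of the realizing function.\<close>

definition extension_property :: "'a set \<Rightarrow> ('a set \<Rightarrow> real) \<Rightarrow> bool" where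
  "extension_property X \<delta> \<longleftrightarrow>
     (\<forall>S f. S \<in> Fpow X \<longrightarrow> S \<noteq> {} \<longrightarrow> adm S \<delta> f \<longrightarrow> (\<exists>x\<in>X. \<forall>A\<subseteq>S. \<delta> (insert x A) = f A))"

lemma separable_div_image:
  assumes "separable_div X \<delta>" "\<And>A. A \<in> Fpow X \<Longrightarrow> \<rho> (j ` A) = \<delta> A"
  shows "separable_div (j ` X) \<rho>"
proof -
  obtain D where D: "countable D" "D \<subseteq> X" "\<forall>x\<in>X. \<forall>e>0. \<exists>y\<in>D. \<delta> {x, y} < e"
    using assms(1) unfolding separable_div_def by blast
  have iso: "\<rho> {j x, j y} = \<delta> {x, y}" if "x \<in> X" "y \<in> X" for x y
    using assms(2)[of "{x, y}"] that by (simp add: Fpow_iff)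
  have "\<exists>z\<in>j ` D. \<rho> {w, z} < e" if w: "w \<in> j ` X" and e: "0 < e" for w e
  proof -
    obtain x where x: "x \<in> X" "w = j x" using w by blast
    obtain y where y: "y \<in> D" "\<delta> {x, y} < e" using D(3) x(1) e by blast
    then have "\<rho> {w, j y} < e" using iso[of x y] x D(2) by auto
    then show ?thesis using y(1) by blast
  qed
  then show ?thesis using D(1,2) unfolding separable_div_def
    by (intro exI[of _ "j ` D"]) (simp add: image_mono)
qed

text \<open>The invariant of the induction over stages. Its last clause makes the tag
  \<open>n\<close> fresh, so that no name \<open>Adj n G\<close> coincides with a point already
  present.\<close>

definition stage_ok :: "nat \<Rightarrow> 'a pt set \<Rightarrow> ('a pt set \<Rightarrow> real) \<Rightarrow> bool" where
  "stage_ok n Y \<epsilon> \<longleftrightarrow> diversity Y \<epsilon> \<and> Y \<noteq> {} \<and> separable_div Y \<epsilon> \<and> (\<forall>m G. Adj m G \<in> Y \<longrightarrow> m < n)"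

definition next_carrier :: "nat \<Rightarrow> 'a pt set \<Rightarrow> ('a pt set \<Rightarrow> real) \<Rightarrow> 'a pt set" where
  "next_carrier n Y \<epsilon> = name n Y \<epsilon> ` E_fin Y \<epsilon>"

definition next_div :: "nat \<Rightarrow> 'a pt set \<Rightarrow> ('a pt set \<Rightarrow> real) \<Rightarrow> 'a pt set \<Rightarrow> real" where
  "next_div n Y \<epsilon> A = hat Y {g \<in> E_fin Y \<epsilon>. name n Y \<epsilon> g \<in> A}"

lemma stage_Suc:
  "stage X \<delta> (Suc n) =
    (next_carrier n (fst (stage X \<delta> n)) (snd (stage X \<delta> n)), next_div n (fst (stage X \<delta> n)) (snd (stage X \<delta> n)))"
  by (cases "stage X \<delta> n") (simp add: next_carrier_def next_div_def fun_eq_iff)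

context
  fixes n :: nat and Y :: "'a pt set" and \<epsilon> :: "'a pt set \<Rightarrow> real"
  assumes ok: "stage_ok n Y \<epsilon>"
begin

private lemma d: "diversity Y \<epsilon>" and ne: "Y \<noteq> {}" and sep: "separable_div Y \<epsilon>"
  and tag: "Adj m G \<in> Y \<Longrightarrow> m < n"
  using ok by (auto simp: stage_ok_def)

lemma name_kappa: "y \<in> Y \<Longrightarrow> name n Y \<epsilon> (kappa Y \<epsilon> y) = y"
  using inj_on_kappa[OF d] by (simp add: name_def)

lemma name_new:
  assumes g: "g \<in> E_fin Y \<epsilon>" "g \<notin> kappa Y \<epsilon> ` Y"
  shows "\<exists>S f. fset S \<subseteq> Y \<and> f \<in> E (fset S) \<epsilon> \<and> g = support_ext Y \<epsilon> (fset S) f \<and>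
    name n Y \<epsilon> g = Adj n (graph_on S f)"
proof -
  obtain S f where Sf: "finite S" "S \<noteq> {}" "S \<subseteq> Y" "f \<in> E S \<epsilon>" "g = support_ext Y \<epsilon> S f"
    using E_finE[OF d g(1)] by metis
  obtain S' where S': "S = fset S'" using Sf(1) by (metis Abs_fset_inverse mem_Collect_eq)
  let ?P = "\<lambda>c. \<exists>S f. S \<noteq> {||} \<and> fset S \<subseteq> Y \<and> f \<in> E (fset S) \<epsilon> \<and>
                     g = support_ext Y \<epsilon> (fset S) f \<and> c = Adj n (graph_on S f)"
  have "S' \<noteq> {||}" using Sf S' by auto
  then have "?P (Adj n (graph_on S' f))" using Sf S' by blast
  then have "?P (SOME c. ?P c)" by (rule someI)
  moreover have "name n Y \<epsilon> g = (SOME c. ?P c)" using g(2) by (simp add: name_def)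
  ultimately have "?P (name n Y \<epsilon> g)" by simp
  then show ?thesis by blast
qed

text \<open>The tag separates new names from old points. Among new names the graph determines the
  support and the function on it, hence the extension, whichever presentation was chosen.\<close>

lemma inj_on_name: "inj_on (name n Y \<epsilon>) (E_fin Y \<epsilon>)"
proof (rule inj_onI)
  fix g g' assume g: "g \<in> E_fin Y \<epsilon>" and g': "g' \<in> E_fin Y \<epsilon>" and eq: "name n Y \<epsilon> g = name n Y \<epsilon> g'"
  have new: "name n Y \<epsilon> k \<notin> Y" if "k \<in> E_fin Y \<epsilon>" "k \<notin> kappa Y \<epsilon> ` Y" for k
    using name_new[OF that] tag by (metis less_irrefl)
  have old: "name n Y \<epsilon> k \<in> Y" if "k \<in> kappa Y \<epsilon> ` Y" for k
    using that name_kappa by auto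
  show "g = g'"
  proof (cases "g \<in> kappa Y \<epsilon> ` Y")
    case True
    moreover from this have "g' \<in> kappa Y \<epsilon> ` Y" using old[of g] new[OF g'] eq by auto
    ultimately show ?thesis using eq name_kappa by auto
  next
    case False
    then have False': "g' \<notin> kappa Y \<epsilon> ` Y" using old[of g'] new[OF g] eq by auto
    obtain S f where S: "fset S \<subseteq> Y" "f \<in> E (fset S) \<epsilon>" "g = support_ext Y \<epsilon> (fset S) f"
      "name n Y \<epsilon> g = Adj n (graph_on S f)" using name_new[OF g False] by blast
    obtain T k where T: "k \<in> E (fset T) \<epsilon>" "g' = support_ext Y \<epsilon> (fset T) k"
      "name n Y \<epsilon> g' = Adj n (graph_on T k)" using name_new[OF g' False'] by blast
    have graph: "graph_on S f = graph_on T k" using S(4) T(3) eq by simp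
    then have "S = T" by (rule graph_on_inject)
    moreover have "f = k"
      by (rule E_eqI[OF diversity_subset[OF d S(1)]])
        (use S T \<open>S = T\<close> graph_on_inject(2)[OF graph] in auto)
    ultimately show ?thesis using S T by simp
  qed
qed

lemma next_div_name:
  assumes "F \<subseteq> E_fin Y \<epsilon>"
  shows "next_div n Y \<epsilon> (name n Y \<epsilon> ` F) = hat Y F"
proof -
  have "{g \<in> E_fin Y \<epsilon>. name n Y \<epsilon> g \<in> name n Y \<epsilon> ` F} = F"
    using assms inj_on_name by (auto dest: inj_onD)
  then show ?thesis by (simp add: next_div_def)
qed

lemma subset_next_carrier: "Y \<subseteq> next_carrier n Y \<epsilon>"
proof
  fix y assume y: "y \<in> Y"
  show "y \<in> next_carrier n Y \<epsilon>"
    unfolding next_carrier_def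
    by (rule image_eqI[of _ _ "kappa Y \<epsilon> y"]) (simp_all add: name_kappa y kappa_in_E_fin[OF d])
qed

lemma name_kappa_image: "A \<subseteq> Y \<Longrightarrow> name n Y \<epsilon> ` kappa Y \<epsilon> ` A = A"
  using name_kappa by (force simp: image_image)

lemma next_div_old:
  assumes A: "A \<in> Fpow Y"
  shows "next_div n Y \<epsilon> A = \<epsilon> A"
proof -
  have "A \<subseteq> Y" using A by (simp add: Fpow_iff)
  then have "next_div n Y \<epsilon> A = hat Y (kappa Y \<epsilon> ` A)"
    using next_div_name[of "kappa Y \<epsilon> ` A"] name_kappa_image kappa_in_E_fin[OF d] by auto
  then show ?thesis using hat_kappa[OF d ne A] by simp
qed

lemma next_extension:
  assumes S: "S \<in> Fpow Y" "S \<noteq> {}" and f: "adm S \<epsilon> f"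
  shows "\<exists>x\<in>next_carrier n Y \<epsilon>. \<forall>A\<subseteq>S. next_div n Y \<epsilon> (insert x A) = f A"
proof -
  have S': "finite S" "S \<noteq> {}" "S \<subseteq> Y" using S by (auto simp: Fpow_iff)
  have dS: "diversity S \<epsilon>" by (rule diversity_subset[OF d S'(3)])
  define f' where "f' = restrict f (Fpow S)"
  have f': "f' \<in> E S \<epsilon>" unfolding f'_def by (rule restrict_in_E[OF dS f])
  define g where "g = support_ext Y \<epsilon> S f'"
  have g: "g \<in> E_fin Y \<epsilon>" unfolding g_def by (rule support_ext_in_E_fin[OF d S' f'])
  have "next_div n Y \<epsilon> (insert (name n Y \<epsilon> g) A) = f A" if "A \<subseteq> S" for A
  proof -
    have A: "A \<in> Fpow Y" "A \<in> Fpow S" using that S by (auto simp: Fpow_iff intro: finite_subset)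
    have "A \<subseteq> Y" using A by (simp add: Fpow_iff)
    have "next_div n Y \<epsilon> (name n Y \<epsilon> ` insert g (kappa Y \<epsilon> ` A)) = hat Y (insert g (kappa Y \<epsilon> ` A))"
      by (rule next_div_name) (use g kappa_in_E_fin[OF d] \<open>A \<subseteq> Y\<close> in auto)
    then have "next_div n Y \<epsilon> (insert (name n Y \<epsilon> g) A) = hat Y (insert g (kappa Y \<epsilon> ` A))"
      using name_kappa_image[OF \<open>A \<subseteq> Y\<close>] by simp
    also have "\<dots> = g A" by (rule hat_insert_kappa[OF d ne _ A(1)]) (use g E_fin_subset in auto)
    also have "\<dots> = f A"
      using support_ext_on[OF d S' E_adm[OF dS f'] A(2)] A(2) by (simp add: g_def f'_def)
    finally show ?thesis .
  qed
  then show ?thesis using g by (auto simp: next_carrier_def)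
qed

lemma stage_ok_next: "stage_ok (Suc n) (next_carrier n Y \<epsilon>) (next_div n Y \<epsilon>)"
proof -
  have "diversity (E_fin Y \<epsilon>) (hat Y)"
    by (rule diversity_subset[OF hat_diversity[OF d ne] E_fin_subset])
  moreover have iso: "next_div n Y \<epsilon> (name n Y \<epsilon> ` F) = hat Y F" if "F \<in> Fpow (E_fin Y \<epsilon>)" for F
    using that by (intro next_div_name) (simp add: Fpow_iff)
  ultimately have "diversity (next_carrier n Y \<epsilon>) (next_div n Y \<epsilon>)"
    unfolding next_carrier_def by (rule diversity_image)
  moreover have "separable_div (next_carrier n Y \<epsilon>) (next_div n Y \<epsilon>)"
    unfolding next_carrier_def by (rule separable_div_image[OF separable_E_fin[OF d ne sep] iso])
  moreover have "m < Suc n" if "Adj m G \<in> next_carrier n Y \<epsilon>" for m G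
  proof -
    from that obtain g where g: "g \<in> E_fin Y \<epsilon>" "Adj m G = name n Y \<epsilon> g" by (auto simp: next_carrier_def)
    show ?thesis
    proof (cases "g \<in> kappa Y \<epsilon> ` Y")
      case True
      then show ?thesis using g name_kappa tag[of m G] by auto
    next
      case False
      then show ?thesis using name_new[OF g(1) False] g by auto
    qed
  qed
  ultimately show ?thesis
    using ne subset_next_carrier by (auto simp: stage_ok_def)
qed

end

section \<open>Properties passed from the stages to the direct limit\<close>

context
  fixes X :: "'a set" and \<delta> :: "'a set \<Rightarrow> real"
  assumes dX: "diversity X \<delta>" and neX: "X \<noteq> {}" and sepX: "separable_div X \<delta>"
begin

abbreviation carr :: "nat \<Rightarrow> 'a pt set" where "carr n \<equiv> fst (stage X \<delta> n)"
abbreviation sdiv :: "nat \<Rightarrow> 'a pt set \<Rightarrow> real" where "sdiv n \<equiv> snd (stage X \<delta> n)"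

lemma stage_ok_stage: "stage_ok n (carr n) (sdiv n)"
proof (induction n)
  case 0
  have "\<delta> (Base -` Base ` A) = \<delta> A" for A by (simp add: inj_vimage_image_eq inj_def)
  then have "diversity (Base ` X) (\<lambda>A. \<delta> (Base -` A))" "separable_div (Base ` X) (\<lambda>A. \<delta> (Base -` A))"
    using diversity_image[OF dX, of "\<lambda>A. \<delta> (Base -` A)" Base]
      separable_div_image[OF sepX, of "\<lambda>A. \<delta> (Base -` A)" Base] by auto
  then show ?case using neX by (auto simp: stage_ok_def)
next
  case (Suc n)
  then show ?case using stage_ok_next[OF Suc] by (simp only: stage_Suc fst_conv snd_conv)
qed

lemma stage_mono: "m \<le> n \<Longrightarrow> carr m \<subseteq> carr n \<and> (\<forall>A\<in>Fpow (carr m). sdiv n A = sdiv m A)"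
proof (induction n rule: dec_induct)
  case (step n)
  have "sdiv (Suc n) A = sdiv n A" if "A \<in> Fpow (carr n)" for A
    using next_div_old[OF stage_ok_stage that] by (simp only: stage_Suc snd_conv)
  moreover have "carr n \<subseteq> carr (Suc n)"
    using subset_next_carrier[OF stage_ok_stage] by (simp only: stage_Suc fst_conv)
  ultimately show ?case using step.IH by (auto simp: Fpow_iff)
qed simp

lemma Fpow_limit:
  assumes "A \<in> Fpow (limit_carrier X \<delta>)"
  obtains n where "A \<in> Fpow (carr n)"
proof -
  have "\<exists>n. A \<subseteq> carr n" if "finite A" "A \<subseteq> limit_carrier X \<delta>" for A
    using that
  proof (induction A)
    case (insert a A)
    then obtain n m where "A \<subseteq> carr n" "a \<in> carr m" by (auto simp: limit_carrier_def)
    then have "insert a A \<subseteq> carr (max n m)"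
      using stage_mono[of n "max n m"] stage_mono[of m "max n m"] by auto
    then show ?case by blast
  qed simp
  then show ?thesis using that assms by (auto simp: Fpow_iff)
qed

lemma limit_div_eq:
  assumes A: "A \<in> Fpow (carr n)"
  shows "limit_div X \<delta> A = sdiv n A"
proof -
  let ?k = "LEAST n. A \<subseteq> carr n"
  have "A \<subseteq> carr n" using A by (simp add: Fpow_iff)
  then have "A \<subseteq> carr ?k" "?k \<le> n" by (rule LeastI, rule Least_le)
  then have "sdiv n A = sdiv ?k A" using stage_mono[of ?k n] A by (auto simp: Fpow_iff)
  then show ?thesis by (simp add: limit_div_def)
qed

lemma carr_subset_limit: "carr n \<subseteq> limit_carrier X \<delta>"
  by (auto simp: limit_carrier_def)

lemma stage_diversity: "diversity (carr n) (sdiv n)"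
  using stage_ok_stage by (auto simp: stage_ok_def)

lemma limit_diversity: "diversity (limit_carrier X \<delta>) (limit_div X \<delta>)"
proof (rule diversityI)
  fix B assume "B \<in> Fpow (limit_carrier X \<delta>)"
  then obtain n where B: "B \<in> Fpow (carr n)" by (rule Fpow_limit)
  show "0 \<le> limit_div X \<delta> B"
    using diversity_nonneg[OF stage_diversity B] limit_div_eq[OF B] by simp
  show "limit_div X \<delta> B = 0 \<longleftrightarrow> card B \<le> 1"
    using stage_diversity[of n] B limit_div_eq[OF B] unfolding diversity_def by simp
  fix A
  { assume "A \<subseteq> B"
    then have "A \<in> Fpow (carr n)" using B by (auto simp: Fpow_iff intro: finite_subset)
    then show "limit_div X \<delta> A \<le> limit_div X \<delta> B"
      using diversity_mono[OF stage_diversity B \<open>A \<subseteq> B\<close>] limit_div_eq B by simp }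
  assume "A \<in> Fpow (limit_carrier X \<delta>)" and ne: "A \<inter> B \<noteq> {}"
  then obtain m where A: "A \<in> Fpow (carr m)" using Fpow_limit by metis
  have "A \<in> Fpow (carr (max m n))" "B \<in> Fpow (carr (max m n))"
    using A B stage_mono[of n "max m n"] stage_mono[of m "max m n"] by (auto simp: Fpow_iff)
  then show "limit_div X \<delta> (A \<union> B) \<le> limit_div X \<delta> A + limit_div X \<delta> B"
    using diversity_union[OF stage_diversity _ _ ne] limit_div_eq Fpow_Un by metis
qed

lemma limit_separable: "separable_div (limit_carrier X \<delta>) (limit_div X \<delta>)"
proof -
  have "\<forall>n. \<exists>D. countable D \<and> D \<subseteq> carr n \<and> (\<forall>x\<in>carr n. \<forall>e>0. \<exists>y\<in>D. sdiv n {x, y} < e)"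
    using stage_ok_stage unfolding stage_ok_def separable_div_def by blast
  then obtain D where D: "\<And>n. countable (D n)" "\<And>n. D n \<subseteq> carr n"
    "\<And>n x e. x \<in> carr n \<Longrightarrow> 0 < e \<Longrightarrow> \<exists>y\<in>D n. sdiv n {x, y} < e" by metis
  have "\<exists>y\<in>(\<Union>n. D n). limit_div X \<delta> {x, y} < e" if "x \<in> limit_carrier X \<delta>" "0 < e" for x e
  proof -
    from that obtain n where n: "x \<in> carr n" by (auto simp: limit_carrier_def)
    obtain y where y: "y \<in> D n" "sdiv n {x, y} < e" using D(3)[OF n \<open>0 < e\<close>] by blast
    then have "limit_div X \<delta> {x, y} = sdiv n {x, y}"
      using n D(2)[of n] by (intro limit_div_eq) (auto simp: Fpow_iff)
    then show ?thesis using y by (intro bexI[of _ y]) auto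
  qed
  moreover have "(\<Union>n. D n) \<subseteq> limit_carrier X \<delta>" using D(2) by (auto simp: limit_carrier_def)
  ultimately show ?thesis
    unfolding separable_div_def using D(1) by (intro exI[of _ "\<Union>n. D n"]) auto
qed

lemma limit_extension: "extension_property (limit_carrier X \<delta>) (limit_div X \<delta>)"
  unfolding extension_property_def
proof (intro allI impI)
  fix S f assume S: "S \<in> Fpow (limit_carrier X \<delta>)" "S \<noteq> {}" and f: "adm S (limit_div X \<delta>) f"
  obtain n where n: "S \<in> Fpow (carr n)" using S(1) by (rule Fpow_limit)
  have "adm S (sdiv n) f"
  proof -
    have "limit_div X \<delta> A = sdiv n A" if "A \<in> Fpow S" for A
      using that n by (intro limit_div_eq) (auto simp: Fpow_iff)
    then show ?thesis using f unfolding adm_def compatible_def by (simp add: Fpow_Un)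
  qed
  then obtain x where x: "x \<in> carr (Suc n)" "\<And>A. A \<subseteq> S \<Longrightarrow> sdiv (Suc n) (insert x A) = f A"
    using next_extension[OF stage_ok_stage n S(2), of f] by (auto simp only: stage_Suc fst_conv snd_conv)
  have "limit_div X \<delta> (insert x A) = f A" if "A \<subseteq> S" for A
  proof -
    have "insert x A \<in> Fpow (carr (Suc n))"
      using that n x(1) stage_mono[of n "Suc n"] by (auto simp: Fpow_iff intro: finite_subset simp del: stage.simps)
    then show ?thesis by (simp only: limit_div_eq x(2)[OF that])
  qed
  then show "\<exists>x\<in>limit_carrier X \<delta>. \<forall>A\<subseteq>S. limit_div X \<delta> (insert x A) = f A"
    using x(1) carr_subset_limit by blast
qed

end

section \<open>Completion\<close>

lemma adm_image:
  assumes f: "adm (j ` X) \<rho> f" and iso: "\<And>A. A \<in> Fpow X \<Longrightarrow> \<rho> (j ` A) = \<delta> A"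
  shows "adm X \<delta> (\<lambda>A. f (j ` A))"
proof -
  have mem: "j ` A \<in> Fpow (j ` X)" if "A \<in> Fpow X" for A using that by (auto simp: Fpow_iff)
  show ?thesis
    unfolding adm_def compatible_def
  proof (intro conjI allI ballI impI)
    fix A B assume *: "A \<in> Fpow X" "B \<in> Fpow X"
    show "\<delta> (A \<union> B) \<le> f (j ` A) + f (j ` B)"
      using adm_ge[OF f mem[OF *(1)] mem[OF *(2)]] iso[OF Fpow_Un[OF *]] by (simp add: image_Un)
    show "f (j ` (A \<union> B)) \<le> f (j ` A) + f (j ` B)"
      using adm_union[OF f mem[OF *(1)] mem[OF *(2)]] by (simp add: image_Un)
  next
    fix A B assume "B \<in> Fpow X" "A \<subseteq> B"
    then show "f (j ` A) \<le> f (j ` B)" by (intro adm_mono[OF f mem]) auto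
  next
    fix A C assume *: "A \<in> Fpow X" "C \<in> Fpow X" "A \<inter> C \<noteq> {}"
    then have "j ` A \<inter> j ` C \<noteq> {}" by auto
    then show "f (j ` (A \<union> C)) \<le> f (j ` A) + \<delta> C"
      using compatible_union[OF adm_compatible[OF f] mem[OF *(1)] mem[OF *(2)]] iso[OF *(2)]
      by (simp add: image_Un)
  qed (use adm_empty[OF f] in simp)
qed

lemma extension_property_image:
  assumes ext: "extension_property X \<delta>" and iso: "\<And>A. A \<in> Fpow X \<Longrightarrow> \<rho> (j ` A) = \<delta> A"
  shows "extension_property (j ` X) \<rho>"
  unfolding extension_property_def
proof (intro allI impI)
  fix S f assume S: "S \<in> Fpow (j ` X)" "S \<noteq> {}" and f: "adm S \<rho> f"
  obtain T where T: "T \<in> Fpow X" "S = j ` T" using S(1) by (rule Fpow_imageE)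
  have sub: "A \<in> Fpow X" if "A \<subseteq> T" for A using that T by (auto simp: Fpow_iff intro: finite_subset)
  have "adm T \<delta> (\<lambda>A. f (j ` A))"
  proof (rule adm_image)
    show "adm (j ` T) \<rho> f" using f T by simp
    show "\<rho> (j ` A) = \<delta> A" if "A \<in> Fpow T" for A
      using that by (intro iso sub) (simp add: Fpow_iff)
  qed
  then obtain x where x: "x \<in> X" "\<And>A. A \<subseteq> T \<Longrightarrow> \<delta> (insert x A) = f (j ` A)"
    using ext T S(2) unfolding extension_property_def by (metis image_is_empty)
  have "\<rho> (insert (j x) A) = f A" if "A \<subseteq> S" for A
  proof -
    obtain B where B: "B \<subseteq> T" "A = j ` B" using \<open>A \<subseteq> S\<close> T by (auto simp: subset_image_iff)
    have "insert x B \<in> Fpow X" using sub[OF B(1)] x by (auto simp: Fpow_iff)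
    from iso[OF this] show ?thesis using x(2)[OF B(1)] B(2) by simp
  qed
  then show "\<exists>x\<in>j ` X. \<forall>A\<subseteq>S. \<rho> (insert x A) = f A" using x(1) by blast
qed

definition dense_div :: "'a set \<Rightarrow> 'a set \<Rightarrow> ('a set \<Rightarrow> real) \<Rightarrow> bool" where
  "dense_div D U \<delta> \<longleftrightarrow> D \<subseteq> U \<and> (\<forall>x\<in>U. \<forall>e>0. \<exists>y\<in>D. \<delta> {x, y} < e)"

text \<open>Like \<open>dense_div\<close>, this restates a metric notion through values on pairs, so
  that the arguments after this section work with inequalities only.\<close>

definition complete_div :: "'a set \<Rightarrow> ('a set \<Rightarrow> real) \<Rightarrow> bool" where
  "complete_div U \<delta> \<longleftrightarrow> (\<forall>\<sigma>. range \<sigma> \<subseteq> U \<longrightarrow> (\<forall>e>0. \<exists>N::nat. \<forall>m n. N \<le> m \<longrightarrow> N \<le> n \<longrightarrow> \<delta> {\<sigma> m, \<sigma> n} < e) \<longrightarrow>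
     (\<exists>x\<in>U. \<forall>e>0. \<exists>N. \<forall>n\<ge>N. \<delta> {\<sigma> n, x} < e))"

context
  fixes X :: "'a set" and \<delta> :: "'a set \<Rightarrow> real" and U :: "'b set" and \<delta>U :: "'b set \<Rightarrow> real"
    and \<iota> :: "'a \<Rightarrow> 'b"
  assumes dX: "diversity X \<delta>" and compl: "diversity_completion X \<delta> U \<delta>U \<iota>"
begin

interpretation M: Metric_space U "induced_metric U \<delta>U"
  using compl by (simp add: diversity_completion_def)

lemma completion_iso: "A \<in> Fpow X \<Longrightarrow> \<delta>U (\<iota> ` A) = \<delta> A"
  using compl by (simp add: diversity_completion_def)

lemma completion_complete: "complete_div U \<delta>U"
  unfolding complete_div_def
proof (intro allI impI)
  fix \<sigma> :: "nat \<Rightarrow> 'b"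
  assume \<sigma>: "range \<sigma> \<subseteq> U" and Cauchy: "\<forall>e>0. \<exists>N. \<forall>m n. N \<le> m \<longrightarrow> N \<le> n \<longrightarrow> \<delta>U {\<sigma> m, \<sigma> n} < e"
  have \<sigma>U: "\<sigma> n \<in> U" for n using \<sigma> by auto
  have "M.MCauchy \<sigma>"
    using \<sigma> Cauchy by (simp add: M.MCauchy_def induced_metric_def \<sigma>U)
  then obtain x where "limitin M.mtopology \<sigma> x sequentially"
    using compl unfolding diversity_completion_def M.mcomplete_def by blast
  then have "x \<in> U" "\<forall>e>0. \<exists>N. \<forall>n\<ge>N. \<delta>U {\<sigma> n, x} < e"
    by (auto simp: M.limitin_metric eventually_sequentially induced_metric_def \<sigma>U)
  then show "\<exists>x\<in>U. \<forall>e>0. \<exists>N. \<forall>n\<ge>N. \<delta>U {\<sigma> n, x} < e" by blast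
qed

lemma completion_dense: "dense_div (\<iota> ` X) U \<delta>U"
proof -
  have "\<iota> ` X \<subseteq> U" and cl: "M.mtopology closure_of (\<iota> ` X) = U"
    using compl by (auto simp: diversity_completion_def)
  moreover have "\<exists>y\<in>\<iota> ` X. \<delta>U {x, y} < e" if x: "x \<in> U" and e: "0 < e" for x e
  proof -
    have "x \<in> M.mtopology closure_of (\<iota> ` X)" using x cl by simp
    then have "\<exists>y\<in>\<iota> ` X. y \<in> M.mball x e"
      using e unfolding M.metric_closure_of by blast
    then show ?thesis by (auto simp: induced_metric_def)
  qed
  ultimately show ?thesis by (auto simp: dense_div_def)
qed

text \<open>After an enumeration of \<open>W\<close>, pointwise convergence of \<open>s n\<close>
  becomes convergence of tuples in the product topology, where continuity of
  \<open>\<delta>U\<close> is assumed.\<close>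

lemma completion_limit:
  assumes W: "W \<in> Fpow U" and s: "\<And>n u. u \<in> W \<Longrightarrow> s n u \<in> U"
    and lim: "\<And>u. u \<in> W \<Longrightarrow> (\<lambda>n. \<delta>U {s n u, u}) \<longlonglongrightarrow> 0"
  shows "(\<lambda>n. \<delta>U (s n ` W)) \<longlonglongrightarrow> \<delta>U W"
proof -
  have fin: "finite W" and WU: "W \<subseteq> U" using W by (auto simp: Fpow_iff)
  obtain w where w: "bij_betw w {..<card W} W"
    using ex_bij_betw_nat_finite[OF fin] by (auto simp: lessThan_atLeast0)
  have wW: "w i \<in> W" if "i < card W" for i using w that by (auto simp: bij_betw_def)
  define k where "k = card W"
  \<comment> \<open>The restriction is essential: points of the product topology are extensional
    functions on the index set.\<close>
  define a where "a n = (\<lambda>i\<in>{..<k}. s n (w i))" for n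
  define l where "l = (\<lambda>i\<in>{..<k}. w i)"
  have "limitin (product_topology (\<lambda>_. M.mtopology) {..<k}) a l sequentially"
    unfolding limitin_componentwise
  proof (intro conjI ballI)
    fix i assume i: "i \<in> {..<k}"
    have "limitin M.mtopology (\<lambda>n. s n (w i)) (w i) sequentially"
      unfolding M.limitin_metric
    proof (intro conjI allI impI)
      fix e :: real assume "0 < e"
      then have "\<forall>\<^sub>F n in sequentially. \<delta>U {s n (w i), w i} < e"
        using lim[OF wW, of i] i by (auto simp: k_def intro: order_tendstoD)
      then show "\<forall>\<^sub>F n in sequentially. s n (w i) \<in> U \<and> induced_metric U \<delta>U (s n (w i)) (w i) < e"
        by eventually_elim (use i s wW WU in \<open>auto simp: induced_metric_def k_def\<close>)
    qed (use i wW WU in \<open>auto simp: k_def\<close>)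
    then show "limitin M.mtopology (\<lambda>n. a n i) (l i) sequentially"
      using i by (simp add: a_def l_def)
  next
    show "\<forall>\<^sub>F n in sequentially. a n \<in> topspace (product_topology (\<lambda>_. M.mtopology) {..<k})"
      using s wW by (auto simp: a_def k_def)
  qed (simp add: l_def)
  moreover have "continuous_map (product_topology (\<lambda>_. M.mtopology) {..<k}) euclideanreal
      (\<lambda>a. \<delta>U (a ` {..<k}))"
    using compl by (simp add: diversity_completion_def)
  ultimately have "limitin euclideanreal ((\<lambda>a. \<delta>U (a ` {..<k})) \<circ> a) (\<delta>U (l ` {..<k})) sequentially"
    by (rule continuous_map_limit[rotated])
  moreover have "l ` {..<k} = W" using w by (simp add: l_def k_def bij_betw_def)
  moreover have "a n ` {..<k} = s n ` W" for n
    using image_image[of "s n" w "{..<k}"] w by (simp add: a_def k_def bij_betw_def)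
  ultimately show ?thesis by (simp add: comp_def)
qed

text \<open>\<open>diversity_completion\<close> assumes of \<open>\<delta>U\<close> only a metric,
  continuity and the values on the image of \<open>X\<close>. Nonnegativity, monotonicity and
  subadditivity hold on the dense image and pass to limits.\<close>

lemma completion_diversity: "diversity U \<delta>U"
proof -
  let ?D = "\<iota> ` X"
  have dD: "diversity ?D \<delta>U" by (rule diversity_image[OF dX completion_iso])
  have DU: "?D \<subseteq> U" using completion_dense by (simp add: dense_div_def)
  have "\<exists>y. u \<in> U \<longrightarrow> y \<in> ?D \<and> \<delta>U {u, y} < inverse (real (Suc n))" for n u
  proof (cases "u \<in> U")
    case True
    have "0 < inverse (real (Suc n))" by simp
    with True show ?thesis using completion_dense unfolding dense_div_def by blast
  qed simp
  note ex = this
  define s where "s n u = (SOME y. u \<in> U \<longrightarrow> y \<in> ?D \<and> \<delta>U {u, y} < inverse (real (Suc n)))" for n u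
  have s: "s n u \<in> ?D \<and> \<delta>U {u, s n u} < inverse (real (Suc n))" if "u \<in> U" for n u
    using someI_ex[OF ex[of u n]] that unfolding s_def by blast
  have lim: "(\<lambda>n. \<delta>U (s n ` W)) \<longlonglongrightarrow> \<delta>U W" if W: "W \<in> Fpow U" for W
  proof (rule completion_limit[OF W])
    fix u assume u: "u \<in> W"
    then have uU: "u \<in> U" using W by (auto simp: Fpow_iff)
    then show sU: "s n u \<in> U" for n using s DU by blast
    show "(\<lambda>n. \<delta>U {s n u, u}) \<longlonglongrightarrow> 0"
    proof (rule real_tendsto_sandwich)
      show "\<forall>\<^sub>F n in sequentially. 0 \<le> \<delta>U {s n u, u}"
        using M.nonneg[of "s _ u" u] sU uU by (simp add: induced_metric_def)
      show "\<forall>\<^sub>F n in sequentially. \<delta>U {s n u, u} \<le> inverse (real (Suc n))"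
        using s[OF uU] by (intro always_eventually) (simp add: insert_commute less_imp_le)
    qed (use LIMSEQ_inverse_real_of_nat in auto)
  qed
  have sF: "s n ` W \<in> Fpow ?D" if "W \<in> Fpow U" for W n
    using that s by (auto simp: Fpow_iff)
  have nonneg: "0 \<le> \<delta>U W" if W: "W \<in> Fpow U" for W
    by (rule LIMSEQ_le_const[OF lim[OF W]]) (use diversity_nonneg[OF dD sF[OF W]] in auto)
  have mono: "\<delta>U V \<le> \<delta>U W" if W: "W \<in> Fpow U" and VW: "V \<subseteq> W" for V W
  proof -
    have V: "V \<in> Fpow U" using W VW by (auto simp: Fpow_iff intro: finite_subset)
    show ?thesis
      by (rule LIMSEQ_le[OF lim[OF V] lim[OF W]])
        (use diversity_mono[OF dD sF[OF W] image_mono[OF VW]] in auto)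
  qed
  show ?thesis
  proof (rule diversityI)
    fix W assume W: "W \<in> Fpow U"
    show "\<delta>U W = 0 \<longleftrightarrow> card W \<le> 1"
    proof
      \<comment> \<open>Strict positivity does not pass to limits; it comes from monotonicity and
        from the induced metric, which separates the points of each pair in
        \<open>W\<close>.\<close>
      assume 0: "\<delta>U W = 0"
      have "a = b" if ab: "a \<in> W" "b \<in> W" for a b
      proof -
        have "a \<in> U" "b \<in> U" using W ab by (auto simp: Fpow_iff)
        moreover have "\<delta>U {a, b} \<le> 0" using mono[OF W, of "{a, b}"] 0 ab by simp
        ultimately show ?thesis
          using M.zero[of a b] M.nonneg[of a b] by (simp add: induced_metric_def)
      qed
      then show "card W \<le> 1" using card_le_Suc0_iff_eq[of W] W by (auto simp: Fpow_iff)
    next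
      assume "card W \<le> 1"
      then consider "W = {}" | u where "W = {u}" "u \<in> U"
        using W by (cases "W = {}") (auto simp: Fpow_iff card_Suc_eq le_Suc_eq)
      then show "\<delta>U W = 0"
      proof cases
        case 1
        then show ?thesis using diversity_empty[OF dD] by simp
      next
        case 2
        then show ?thesis using M.mdist_zero[of u] by (simp add: induced_metric_def)
      qed
    qed
  next
    fix A B assume A: "A \<in> Fpow U" and B: "B \<in> Fpow U" and AB: "A \<inter> B \<noteq> {}"
    have "\<delta>U (s n ` (A \<union> B)) \<le> \<delta>U (s n ` A) + \<delta>U (s n ` B)" for n
      using diversity_union[OF dD sF[OF A, of n] sF[OF B, of n]] AB by (auto simp: image_Un)
    then show "\<delta>U (A \<union> B) \<le> \<delta>U A + \<delta>U B"
      by (intro LIMSEQ_le[OF lim[OF Fpow_Un[OF A B]] tendsto_add[OF lim[OF A] lim[OF B]]]) auto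
  qed (use nonneg mono in auto)
qed

end

section \<open>The extension property of the completion\<close>

lemma insert_lipschitz:
  assumes d: "diversity U \<delta>" and "x \<in> U" "y \<in> U" "A \<in> Fpow U"
  shows "\<bar>\<delta> (insert x A) - \<delta> (insert y A)\<bar> \<le> \<delta> {x, y}"
proof -
  have *: "\<delta> (insert a A) \<le> \<delta> (insert b A) + \<delta> {a, b}" if "a \<in> U" "b \<in> U" for a b
  proof -
    have "\<delta> (insert a A) \<le> \<delta> (insert b A \<union> {a, b})"
      by (rule diversity_mono[OF d]) (use that assms in \<open>auto simp: Fpow_iff\<close>)
    also have "\<dots> \<le> \<delta> (insert b A) + \<delta> {a, b}"
      by (rule diversity_union[OF d]) (use that assms in \<open>auto simp: Fpow_iff\<close>)
    finally show ?thesis .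
  qed
  show ?thesis using *[OF assms(2,3)] *[OF assms(3,2)] by (simp add: insert_commute abs_le_iff)
qed

lemma diversity_triangle_pair:
  assumes d: "diversity U \<delta>" and "x \<in> U" "y \<in> U" "z \<in> U"
  shows "\<delta> {x, z} \<le> \<delta> {x, y} + \<delta> {y, z}"
  using diversity_triangle[OF d, of "{x}" "{y}" "{z}"] assms by (simp add: Fpow_iff insert_commute)

context
  fixes U :: "'a set" and \<delta> :: "'a set \<Rightarrow> real" and D :: "'a set"
  assumes d: "diversity U \<delta>" and dense: "dense_div D U \<delta>" and ext: "extension_property D \<delta>"
begin

private lemma DU: "D \<subseteq> U"
  using dense by (simp add: dense_div_def)

text \<open>The finite set is moved into \<open>D\<close>, and the extension problem there is solved
  exactly.\<close>

lemma approx_extension: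
  assumes S: "S \<in> Fpow U" "S \<noteq> {}" and f: "adm S \<delta> f" and e: "0 < e"
  shows "\<exists>x\<in>U. \<forall>A\<subseteq>S. \<bar>\<delta> (insert x A) - f A\<bar> \<le> e"
proof -
  have S': "finite S" "S \<subseteq> U" using S by (auto simp: Fpow_iff)
  \<comment> \<open>Two Lipschitz estimates are used, one for the target and one for the distances
    to \<open>x\<close>, each with an error of at most
    \<open>card S * \<eta> = e / 2\<close>.\<close>
  define \<eta> where "\<eta> = e / (2 * card S)"
  have "card S > 0" using S S' by (simp add: card_gt_0_iff)
  then have \<eta>: "0 < \<eta>" "card S * \<eta> = e / 2" using e by (simp_all add: \<eta>_def)
  have "\<forall>s\<in>S. \<exists>t. t \<in> D \<and> \<delta> {s, t} < \<eta>" using dense S' \<eta>(1) unfolding dense_div_def by blast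
  then obtain h where h: "\<And>s. s \<in> S \<Longrightarrow> h s \<in> D \<and> \<delta> {s, h s} < \<eta>" by metis
  \<comment> \<open>Values of \<open>f\<close> copied to the moved set need not be admissible there,
    and \<open>h\<close> need not be injective. Extending \<open>f\<close> to all of
    \<open>U\<close> first avoids both problems: any restriction of \<open>g\<close> is
    admissible.\<close>
  define g where "g = support_ext U \<delta> S f"
  have g: "adm U \<delta> g" unfolding g_def by (rule support_ext_adm[OF d S'(1) S(2) S'(2) f])
  have hS: "h ` S \<in> Fpow D" "h ` S \<noteq> {}" "h ` S \<subseteq> U" using S S' h DU by (auto simp: Fpow_iff)
  obtain x where x: "x \<in> D" "\<And>A. A \<subseteq> h ` S \<Longrightarrow> \<delta> (insert x A) = g A"
    using ext hS(1,2) adm_subset[OF g hS(3)] unfolding extension_property_def by blast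
  have xU: "x \<in> U" using x DU by blast
  have "\<bar>\<delta> (insert x A) - f A\<bar> \<le> e" if A: "A \<subseteq> S" for A
  proof -
    have AU: "A \<in> Fpow U" "A \<in> Fpow S" using A S' by (auto simp: Fpow_iff intro: finite_subset)
    have hA: "h ` A \<subseteq> U" "h ` A \<subseteq> h ` S" using A hS(3) by auto
    have "(\<Sum>a\<in>A. \<delta> {a, h a}) \<le> (\<Sum>a\<in>A. \<eta>)"
      by (rule sum_mono) (use A h in \<open>auto simp: less_imp_le\<close>)
    also have "\<dots> \<le> card S * \<eta>"
      using card_mono[OF S'(1) A] \<eta>(1) by (auto intro: mult_right_mono)
    finally have sum: "(\<Sum>a\<in>A. \<delta> {a, h a}) \<le> e / 2" using \<eta>(2) by simp
    have "\<bar>g (h ` A) - g A\<bar> \<le> e / 2"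
      using compatible_lipschitz[OF adm_compatible[OF g] AU(1) hA(1)] sum by linarith
    moreover have "\<bar>\<delta> (insert x (h ` A)) - \<delta> (insert x A)\<bar> \<le> e / 2"
      using compatible_lipschitz[OF adm_compatible[OF adm_kappa[OF d xU]] AU(1) hA(1)] sum by linarith
    moreover have "\<delta> (insert x (h ` A)) = g (h ` A)" by (rule x(2)[OF hA(2)])
    moreover have "g A = f A" unfolding g_def by (rule support_ext_on[OF d S'(1) S(2) S'(2) f AU(2)])
    ultimately show ?thesis by linarith
  qed
  then show ?thesis using xU by blast
qed

text \<open>The diversity \<open>hat S\<close> on \<open>E S \<delta>\<close> contains both the target \<open>f\<close> and the trace of the
  approximate solution \<open>y\<close>, so it amalgamates \<open>S \<union> {y}\<close> with a new point realizing \<open>f\<close>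
  close to \<open>y\<close>.\<close>

lemma improve_extension:
  assumes S: "S \<in> Fpow U" "S \<noteq> {}" and f: "adm S \<delta> f"
    and y: "y \<in> U" "\<And>A. A \<subseteq> S \<Longrightarrow> \<bar>\<delta> (insert y A) - f A\<bar> \<le> e" and e': "0 < e'"
  shows "\<exists>x\<in>U. (\<forall>A\<subseteq>S. \<bar>\<delta> (insert x A) - f A\<bar> \<le> e') \<and> \<delta> {x, y} \<le> e + e'"
proof -
  have S': "finite S" "S \<subseteq> U" using S by (auto simp: Fpow_iff)
  have dS: "diversity S \<delta>" by (rule diversity_subset[OF d S'(2)])
  define j where "j a = (\<lambda>A\<in>Fpow S. \<delta> (insert a A))" for a
  define f0 where "f0 = restrict f (Fpow S)"
  have j: "j a \<in> E S \<delta>" if "a \<in> U" for a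
    unfolding j_def by (intro restrict_in_E dS adm_subset[OF adm_kappa[OF d that]] S')
  have f0: "f0 \<in> E S \<delta>" unfolding f0_def by (rule restrict_in_E[OF dS f])
  have j_kappa: "j ` A = kappa S \<delta> ` A" for A by (simp add: j_def kappa_def)
  \<comment> \<open>\<open>j\<close> embeds \<open>insert y S\<close> isometrically into the
    diversity on \<open>E S \<delta>\<close>; for sets that contain \<open>y\<close> this is
    \<open>hat_insert_kappa\<close> at the function \<open>j y\<close>.\<close>
  have hat_j: "hat S (j ` A) = \<delta> A" if A: "A \<in> Fpow (insert y S)" for A
  proof (cases "y \<in> A")
    case True
    have A': "A - {y} \<in> Fpow S" using A by (auto simp: Fpow_iff)
    have "j ` A = insert (j y) (kappa S \<delta> ` (A - {y}))" using True j_kappa[of "A - {y}"] by blast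
    then have "hat S (j ` A) = j y (A - {y})" using hat_insert_kappa[OF dS S(2) j[OF y(1)] A'] by simp
    also have "\<dots> = \<delta> A" using A' True by (simp add: j_def insert_absorb)
    finally show ?thesis .
  next
    case False
    then have "A \<in> Fpow S" using A by (auto simp: Fpow_iff)
    then show ?thesis using hat_kappa[OF dS S(2)] j_kappa by simp
  qed
  \<comment> \<open>The enlarged target over \<open>insert y S\<close>: it equals \<open>f\<close>
    on subsets of \<open>S\<close>, and its value at \<open>{y}\<close> is the supremum distance of
    \<open>f\<close> and the trace of \<open>y\<close>, at most \<open>e\<close>. It is then
    realized up to \<open>e'\<close>.\<close>
  define g where "g A = hat S (insert f0 (j ` A))" for A
  have "adm (insert y S) \<delta> g"
    unfolding g_def by (rule adm_point[OF hat_diversity[OF dS S(2)] _ hat_j f0]) (use j y S' in auto)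
  moreover have "insert y S \<in> Fpow U" using y S by (auto simp: Fpow_iff)
  ultimately obtain x where x: "x \<in> U" "\<And>A. A \<subseteq> insert y S \<Longrightarrow> \<bar>\<delta> (insert x A) - g A\<bar> \<le> e'"
    using approx_extension[of "insert y S" g e'] e' by blast
  have "g A = f A" if "A \<subseteq> S" for A
  proof -
    have A: "A \<in> Fpow S" using that S' by (auto simp: Fpow_iff intro: finite_subset)
    then show ?thesis
      using hat_insert_kappa[OF dS S(2) f0 A] unfolding g_def j_kappa f0_def by simp
  qed
  then have "\<forall>A\<subseteq>S. \<bar>\<delta> (insert x A) - f A\<bar> \<le> e'" using x(2) by (metis subset_insertI2)
  moreover have "g {y} \<le> e"
  proof -
    have "hat S {f0, j y} \<le> e"
    proof (rule hat_pair_le[OF dS S(2) f0 j[OF y(1)]])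
      fix A assume A: "A \<in> Fpow S"
      then show "\<bar>f0 A - j y A\<bar> \<le> e"
        using y(2)[of A] by (simp add: f0_def j_def Fpow_iff abs_minus_commute)
    qed
    then show ?thesis by (simp add: g_def)
  qed
  then have "\<delta> {x, y} \<le> e + e'" using x(2)[of "{y}"] by simp
  ultimately show ?thesis using x(1) by blast
qed

lemma extension_sequence:
  assumes S: "S \<in> Fpow U" "S \<noteq> {}" and f: "adm S \<delta> f"
  obtains \<sigma> :: "nat \<Rightarrow> 'a" where "range \<sigma> \<subseteq> U"
    "\<And>n A. A \<subseteq> S \<Longrightarrow> \<bar>\<delta> (insert (\<sigma> n) A) - f A\<bar> \<le> (1/2) ^ n"
    "\<And>n. \<delta> {\<sigma> n, \<sigma> (Suc n)} \<le> 2 * (1/2) ^ n"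
proof -
  let ?P = "\<lambda>n x. x \<in> U \<and> (\<forall>A\<subseteq>S. \<bar>\<delta> (insert x A) - f A\<bar> \<le> (1/2) ^ n)"
  have "\<exists>\<sigma>. \<forall>n. ?P n (\<sigma> n) \<and> \<delta> {\<sigma> n, \<sigma> (Suc n)} \<le> 2 * (1/2) ^ n"
  proof (rule dependent_nat_choice)
    show "\<exists>x. ?P 0 x" using approx_extension[OF S f, of 1] by auto
    fix x n assume x: "?P n x"
    have "\<exists>y\<in>U. (\<forall>A\<subseteq>S. \<bar>\<delta> (insert y A) - f A\<bar> \<le> (1/2) ^ Suc n) \<and> \<delta> {y, x} \<le> (1/2) ^ n + (1/2) ^ Suc n"
      by (rule improve_extension[OF S f]) (use x in auto)
    then obtain y where y: "?P (Suc n) y" "\<delta> {y, x} \<le> (1/2) ^ n + (1/2) ^ Suc n" by blast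
    \<comment> \<open>The move is at most 3/2 times \<open>(1/2) ^ n\<close>, which is rounded up to
      the factor 2.\<close>
    moreover have "(1/2 :: real) ^ Suc n = (1/2) ^ n / 2" "0 \<le> (1/2 :: real) ^ n" by simp_all
    ultimately have "\<delta> {y, x} \<le> 2 * (1/2) ^ n" by linarith
    then have "\<delta> {x, y} \<le> 2 * (1/2) ^ n" by (simp add: insert_commute)
    then show "\<exists>y. ?P (Suc n) y \<and> \<delta> {x, y} \<le> 2 * (1/2) ^ n" using y by blast
  qed
  then obtain \<sigma> where \<sigma>: "\<And>n. ?P n (\<sigma> n) \<and> \<delta> {\<sigma> n, \<sigma> (Suc n)} \<le> 2 * (1/2) ^ n" by blast
  show ?thesis by (rule that[of \<sigma>]) (use \<sigma> in auto)
qed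

lemma geometric_Cauchy:
  assumes \<sigma>: "range \<sigma> \<subseteq> U" and step: "\<And>n. \<delta> {\<sigma> n, \<sigma> (Suc n)} \<le> 2 * (1/2) ^ n" and e: "0 < e"
  shows "\<exists>N. \<forall>m n. N \<le> m \<longrightarrow> N \<le> n \<longrightarrow> \<delta> {\<sigma> m, \<sigma> n} < e"
proof -
  have \<sigma>U: "\<sigma> n \<in> U" for n using \<sigma> by auto
  \<comment> \<open>The bound telescopes:
    \<open>2 * (1/2) ^ k = 4 * ((1/2) ^ k - (1/2) ^ (k + 1))\<close>.\<close>
  have bound: "\<delta> {\<sigma> N, \<sigma> (N + k)} \<le> 4 * ((1/2) ^ N - (1/2) ^ (N + k))" for N k
  proof (induction k)
    case 0
    then show ?case using diversity_singleton[OF d \<sigma>U] by simp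
  next
    case (Suc k)
    have "\<delta> {\<sigma> N, \<sigma> (Suc (N + k))} \<le> \<delta> {\<sigma> N, \<sigma> (N + k)} + \<delta> {\<sigma> (N + k), \<sigma> (Suc (N + k))}"
      by (rule diversity_triangle_pair[OF d \<sigma>U \<sigma>U \<sigma>U])
    with Suc step[of "N + k"] show ?case by simp
  qed
  \<comment> \<open>With \<open>e / 8\<close> the telescoped bound is below \<open>e / 2\<close>,
    and any two late terms are compared through the term at \<open>N\<close>.\<close>
  obtain N where N: "(1/2 :: real) ^ N < e / 8"
    using real_arch_pow_inv[of "e / 8" "1/2"] e by auto
  have "\<delta> {\<sigma> N, \<sigma> m} < e / 2" if "N \<le> m" for m
  proof -
    have "0 \<le> (1/2 :: real) ^ m" by simp
    moreover have "\<delta> {\<sigma> N, \<sigma> m} \<le> 4 * ((1/2) ^ N - (1/2) ^ m)" using bound[of N "m - N"] that by simp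
    ultimately show ?thesis using N by argo
  qed
  then have "\<delta> {\<sigma> m, \<sigma> n} < e" if "N \<le> m" "N \<le> n" for m n
    using diversity_triangle_pair[OF d \<sigma>U[of m] \<sigma>U[of N] \<sigma>U[of n]] that
    by (smt (verit) field_sum_of_halves insert_commute)
  then show ?thesis by blast
qed

lemma completion_extension:
  assumes complete: "complete_div U \<delta>"
  shows "extension_property U \<delta>"
  unfolding extension_property_def
proof (intro allI impI)
  fix S f assume S: "S \<in> Fpow U" "S \<noteq> {}" and f: "adm S \<delta> f"
  obtain \<sigma> :: "nat \<Rightarrow> 'a" where \<sigma>: "range \<sigma> \<subseteq> U"
    "\<And>n A. A \<subseteq> S \<Longrightarrow> \<bar>\<delta> (insert (\<sigma> n) A) - f A\<bar> \<le> (1/2) ^ n"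
    "\<And>n. \<delta> {\<sigma> n, \<sigma> (Suc n)} \<le> 2 * (1/2) ^ n"
    using extension_sequence[OF S f] by blast
  obtain x where x: "x \<in> U" "\<And>e. 0 < e \<Longrightarrow> \<exists>N. \<forall>n\<ge>N. \<delta> {\<sigma> n, x} < e"
    using complete \<sigma>(1) geometric_Cauchy[OF \<sigma>(1,3)] unfolding complete_div_def by blast
  have "\<delta> (insert x A) = f A" if A: "A \<subseteq> S" for A
  proof -
    have AU: "A \<in> Fpow U" using A S by (auto simp: Fpow_iff intro: finite_subset)
    have "\<bar>\<delta> (insert x A) - f A\<bar> \<le> 0 + e" if e: "0 < e" for e
    proof -
      obtain N where N: "\<forall>n\<ge>N. \<delta> {\<sigma> n, x} < e / 2" using x(2)[of "e / 2"] e by auto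
      obtain M where M: "(1/2 :: real) ^ M < e / 2"
        using real_arch_pow_inv[of "e / 2" "1/2"] e by auto
      define n where "n = max N M"
      have "(1/2 :: real) ^ n \<le> (1/2) ^ M" by (simp add: n_def power_decreasing)
      moreover have "\<delta> {\<sigma> n, x} < e / 2" using N by (simp add: n_def)
      moreover have "\<bar>\<delta> (insert (\<sigma> n) A) - \<delta> (insert x A)\<bar> \<le> \<delta> {\<sigma> n, x}"
        by (rule insert_lipschitz[OF d _ x(1) AU]) (use \<sigma>(1) in auto)
      ultimately show ?thesis using \<sigma>(2)[OF A, of n] M by linarith
    qed
    then have "\<bar>\<delta> (insert x A) - f A\<bar> \<le> 0" by (rule field_le_epsilon)
    then show ?thesis by simp
  qed
  then show "\<exists>x\<in>U. \<forall>A\<subseteq>S. \<delta> (insert x A) = f A" using x(1) by blast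
qed

end

section \<open>Back and forth\<close>

text \<open>A relation instead of a function makes the notion symmetric, so that the back step is
  the forth step for the converse. Being single-valued and injective follows from equality of values
  (\<open>partial_iso_unique\<close>).\<close>

definition partial_iso :: "'a set \<Rightarrow> ('a set \<Rightarrow> real) \<Rightarrow> ('a \<times> 'a) set \<Rightarrow> bool" where
  "partial_iso U \<delta> R \<longleftrightarrow> R \<subseteq> U \<times> U \<and> (\<forall>T. finite T \<longrightarrow> T \<subseteq> R \<longrightarrow> \<delta> (fst ` T) = \<delta> (snd ` T))"

lemma fst_converse: "fst ` (T\<inverse>) = snd ` T" and snd_converse: "snd ` (T\<inverse>) = fst ` T"
  by force+

lemma partial_iso_converse:
  assumes "partial_iso U \<delta> R" shows "partial_iso U \<delta> (R\<inverse>)"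
  unfolding partial_iso_def
proof (intro conjI allI impI)
  show "R\<inverse> \<subseteq> U \<times> U" using assms by (auto simp: partial_iso_def)
  fix T assume "finite T" "T \<subseteq> R\<inverse>"
  then have "finite (T\<inverse>)" "T\<inverse> \<subseteq> R" by auto
  then have "\<delta> (fst ` (T\<inverse>)) = \<delta> (snd ` (T\<inverse>))" using assms unfolding partial_iso_def by blast
  then show "\<delta> (fst ` T) = \<delta> (snd ` T)" by (simp add: fst_converse snd_converse)
qed

lemma partial_iso_Union:
  assumes piso: "\<And>n. partial_iso U \<delta> (R n)" and mono: "\<And>n. R n \<subseteq> R (Suc n)"
  shows "partial_iso U \<delta> (\<Union>n. R n)"
  unfolding partial_iso_def
proof (intro conjI allI impI)
  show "(\<Union>n. R n) \<subseteq> U \<times> U" using piso by (auto simp: partial_iso_def)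
  have le: "R m \<subseteq> R n" if "m \<le> n" for m n using lift_Suc_mono_le[of R, OF mono that] .
  fix T assume "finite T" "T \<subseteq> (\<Union>n. R n)"
  then have "\<exists>n. T \<subseteq> R n"
  proof (induction T)
    case (insert t T)
    then obtain n m where "T \<subseteq> R n" "t \<in> R m" by auto
    then have "insert t T \<subseteq> R (max n m)" using le[of n "max n m"] le[of m "max n m"] by auto
    then show ?case by blast
  qed simp
  then show "\<delta> (fst ` T) = \<delta> (snd ` T)"
    using piso \<open>finite T\<close> unfolding partial_iso_def by blast
qed

definition rel_closure :: "'a set \<Rightarrow> ('a set \<Rightarrow> real) \<Rightarrow> ('a \<times> 'a) set \<Rightarrow> ('a \<times> 'a) set" where
  "rel_closure U \<delta> R = {(u, v) \<in> U \<times> U. \<forall>e>0. \<exists>(a, b)\<in>R. \<delta> {u, a} < e \<and> \<delta> {v, b} < e}"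

lemma rel_closure_converse: "rel_closure U \<delta> (R\<inverse>) = (rel_closure U \<delta> R)\<inverse>"
  unfolding rel_closure_def by fast

context
  fixes U :: "'a set" and \<delta> :: "'a set \<Rightarrow> real"
  assumes d: "diversity U \<delta>"
begin

text \<open>On two pairs, preservation of values reads
  \<open>\<delta> {a, a'} = \<delta> {b, b'}\<close>, and such a value is 0 exactly when the points
  coincide.\<close>

lemma partial_iso_unique:
  assumes R: "partial_iso U \<delta> R" and ab: "(a, b) \<in> R" "(a', b') \<in> R"
  shows "a = a' \<longleftrightarrow> b = b'"
proof -
  have "\<delta> (fst ` {(a, b), (a', b')}) = \<delta> (snd ` {(a, b), (a', b')})"
    using R ab unfolding partial_iso_def by (metis empty_subsetI finite.simps insert_subset)
  then have eq: "\<delta> {a, a'} = \<delta> {b, b'}" by simp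
  have "a \<in> U" "a' \<in> U" "b \<in> U" "b' \<in> U" using R ab by (auto simp: partial_iso_def)
  then show ?thesis
    using eq diversity_pair_eq_0[OF d] diversity_singleton[OF d] by (metis insert_absorb2)
qed

text \<open>The distances to \<open>u\<close>, read on the range of \<open>R\<close> through the
  inverse \<open>j\<close>, are admissible by \<open>adm_point\<close>; a point \<open>v\<close>
  realizing them is a partner for \<open>u\<close>.\<close>

lemma partial_iso_forth:
  assumes ext: "extension_property U \<delta>" and R: "partial_iso U \<delta> R" "finite R" and u: "u \<in> U"
  shows "\<exists>v\<in>U. partial_iso U \<delta> (insert (u, v) R)"
proof (cases "R = {}")
  case True
  \<comment> \<open>The extension property says nothing about the empty set, so the first point is
    simply paired with itself.\<close>
  have "\<delta> (fst ` T) = \<delta> (snd ` T)" if "T \<subseteq> {(u, u)}" for T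
    using that by (auto simp: subset_singleton_iff)
  then have "partial_iso U \<delta> (insert (u, u) R)" using u True by (simp add: partial_iso_def)
  then show ?thesis using u by blast
next
  case False
  have RU: "R \<subseteq> U \<times> U" using R(1) by (simp add: partial_iso_def)
  have piso: "\<delta> (fst ` T) = \<delta> (snd ` T)" if "T \<subseteq> R" for T
    using R that finite_subset[OF that] by (simp add: partial_iso_def)
  define j where "j b = (SOME a. (a, b) \<in> R)" for b
  have jR: "(j b, b) \<in> R" if "b \<in> snd ` R" for b
    using that someI[of "\<lambda>a. (a, b) \<in> R"] by (auto simp: j_def)
  have j_eq: "j b = a" if "(a, b) \<in> R" for a b
    using partial_iso_unique[OF R(1) that jR[of b]] that by force
  have fst_j: "fst ` T = j ` snd ` T" if "T \<subseteq> R" for T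
    using that j_eq by (force simp: image_image)
  have S: "snd ` R \<in> Fpow U" "snd ` R \<noteq> {}" using R RU False by (auto simp: Fpow_iff)
  have "adm (snd ` R) \<delta> (\<lambda>A. \<delta> (insert u (j ` A)))"
  proof (rule adm_point[OF d _ _ u])
    have "fst ` R \<subseteq> U" using RU by auto
    then show "j ` snd ` R \<subseteq> U" using fst_j[of R] by simp
    fix A assume "A \<in> Fpow (snd ` R)"
    then obtain T where T: "T \<subseteq> R" "A = snd ` T" by (auto simp: Fpow_iff subset_image_iff)
    then show "\<delta> (j ` A) = \<delta> A" using piso[OF T(1)] fst_j[OF T(1)] by simp
  qed
  then obtain v where v: "v \<in> U" "\<And>A. A \<subseteq> snd ` R \<Longrightarrow> \<delta> (insert v A) = \<delta> (insert u (j ` A))"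
    using ext S unfolding extension_property_def by blast
  have "\<delta> (fst ` T) = \<delta> (snd ` T)" if T: "T \<subseteq> insert (u, v) R" for T
  proof (cases "(u, v) \<in> T")
    case True
    let ?T = "T - {(u, v)}"
    have T': "?T \<subseteq> R" using T by blast
    have "T = insert (u, v) ?T" using True by blast
    then have "fst ` T = insert u (fst ` ?T)" "snd ` T = insert v (snd ` ?T)"
      by (metis fst_conv image_insert, metis snd_conv image_insert)
    moreover have "\<delta> (insert v (snd ` ?T)) = \<delta> (insert u (j ` snd ` ?T))"
      by (rule v(2)) (use T' in blast)
    ultimately show ?thesis using fst_j[OF T'] by simp
  next
    case False
    then show ?thesis using T by (intro piso) blast
  qed
  then have "partial_iso U \<delta> (insert (u, v) R)" using u v(1) RU by (simp add: partial_iso_def)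
  then show ?thesis using v(1) by blast
qed

text \<open>One forth step for \<open>R\<close>, then one for the converse of the result, with the
  same point \<open>u\<close>.\<close>

lemma partial_iso_step:
  assumes ext: "extension_property U \<delta>" and R: "partial_iso U \<delta> R" "finite R" and u: "u \<in> U"
  shows "\<exists>R'. partial_iso U \<delta> R' \<and> finite R' \<and> R \<subseteq> R' \<and> u \<in> fst ` R' \<and> u \<in> snd ` R'"
proof -
  obtain v where v: "partial_iso U \<delta> (insert (u, v) R)" using partial_iso_forth[OF ext R u] by blast
  have "finite ((insert (u, v) R)\<inverse>)" using R(2) by simp
  from partial_iso_forth[OF ext partial_iso_converse[OF v] this u]
  obtain w where "partial_iso U \<delta> (insert (u, w) ((insert (u, v) R)\<inverse>))" by blast
  from partial_iso_converse[OF this] have "partial_iso U \<delta> ((insert (u, w) ((insert (u, v) R)\<inverse>))\<inverse>)" .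
  moreover have "(insert (u, w) ((insert (u, v) R)\<inverse>))\<inverse> = insert (w, u) (insert (u, v) R)" by auto
  ultimately have "partial_iso U \<delta> (insert (w, u) (insert (u, v) R))" by simp
  then show ?thesis using R(2) by (intro exI[of _ "insert (w, u) (insert (u, v) R)"]) auto
qed

lemma partial_iso_dense:
  assumes ext: "extension_property U \<delta>" and R0: "partial_iso U \<delta> R0" "finite R0"
    and q: "\<And>n::nat. q n \<in> U"
  shows "\<exists>R. partial_iso U \<delta> R \<and> R0 \<subseteq> R \<and> range q \<subseteq> fst ` R \<and> range q \<subseteq> snd ` R"
proof -
  let ?P = "\<lambda>n R. partial_iso U \<delta> R \<and> finite R \<and> R0 \<subseteq> R"
  have "\<exists>R. \<forall>n. ?P n (R n) \<and> R n \<subseteq> R (Suc n) \<and> q n \<in> fst ` R (Suc n) \<and> q n \<in> snd ` R (Suc n)"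
  proof (rule dependent_nat_choice)
    show "\<exists>R. ?P 0 R" using R0 by blast
    fix R n assume R: "?P n R"
    then obtain R' where "partial_iso U \<delta> R'" "finite R'" "R \<subseteq> R'" "q n \<in> fst ` R'" "q n \<in> snd ` R'"
      using partial_iso_step[OF ext _ _ q[of n], of R] by blast
    with R show "\<exists>R'. ?P (Suc n) R' \<and> R \<subseteq> R' \<and> q n \<in> fst ` R' \<and> q n \<in> snd ` R'" by blast
  qed
  then obtain R where R: "\<And>n. partial_iso U \<delta> (R n)" "R0 \<subseteq> R 0" "\<And>n. R n \<subseteq> R (Suc n)"
    "\<And>n. q n \<in> fst ` R (Suc n)" "\<And>n. q n \<in> snd ` R (Suc n)" by blast
  have "partial_iso U \<delta> (\<Union>n. R n)" by (rule partial_iso_Union[where R = R, OF R(1) R(3)])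
  moreover have "R0 \<subseteq> (\<Union>n. R n)" using R(2) by blast
  moreover have "range q \<subseteq> fst ` (\<Union>n. R n)" "range q \<subseteq> snd ` (\<Union>n. R n)" using R(4,5) by blast+
  ultimately show ?thesis by blast
qed

section \<open>Closing a partial isomorphism with dense domain and range\<close>

lemma subset_rel_closure:
  assumes "R \<subseteq> U \<times> U" shows "R \<subseteq> rel_closure U \<delta> R"
proof
  fix p assume p: "p \<in> R"
  obtain u v where uv: "p = (u, v)" by (cases p)
  then have "u \<in> U" "v \<in> U" using p assms by auto
  then have "\<delta> {u, u} = 0" "\<delta> {v, v} = 0" using diversity_singleton[OF d] by simp_all
  then show "p \<in> rel_closure U \<delta> R"
    using p uv \<open>u \<in> U\<close> \<open>v \<in> U\<close> unfolding rel_closure_def by force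
qed

text \<open>Each pair in \<open>T\<close> is approximated by a pair in \<open>R\<close>, on which
  values are preserved; the Lipschitz estimate bounds the error in both coordinates.\<close>

lemma partial_iso_rel_closure:
  assumes R: "partial_iso U \<delta> R" shows "partial_iso U \<delta> (rel_closure U \<delta> R)"
  unfolding partial_iso_def
proof (intro conjI allI impI)
  show "rel_closure U \<delta> R \<subseteq> U \<times> U" by (auto simp: rel_closure_def)
  fix T assume T: "finite T" "T \<subseteq> rel_closure U \<delta> R"
  have TU: "fst ` T \<subseteq> U" "snd ` T \<subseteq> U" using T(2) by (auto simp: rel_closure_def)
  have "\<bar>\<delta> (fst ` T) - \<delta> (snd ` T)\<bar> \<le> 0 + e" if e: "0 < e" for e
  proof -
    \<comment> \<open>Half of \<open>e\<close> goes to each coordinate; the summand 1 keeps the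
      denominator positive when \<open>T\<close> is empty.\<close>
    define \<eta> where "\<eta> = e / (2 * (real (card T) + 1))"
    have \<eta>: "0 < \<eta>" "real (card T) * \<eta> \<le> e / 2" using e by (simp_all add: \<eta>_def field_simps)
    have "\<exists>p. p \<in> R \<and> \<delta> {fst t, fst p} < \<eta> \<and> \<delta> {snd t, snd p} < \<eta>" if "t \<in> T" for t
      using T(2) that \<eta>(1) unfolding rel_closure_def by fastforce
    then obtain p where p: "\<And>t. t \<in> T \<Longrightarrow> p t \<in> R \<and> \<delta> {fst t, fst (p t)} < \<eta> \<and> \<delta> {snd t, snd (p t)} < \<eta>"
      by metis
    have pU: "(\<lambda>t. fst (p t)) ` T \<subseteq> U" "(\<lambda>t. snd (p t)) ` T \<subseteq> U"
    proof -
      have "R \<subseteq> U \<times> U" using R by (simp add: partial_iso_def)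
      then have "p t \<in> U \<times> U" if "t \<in> T" for t using p[OF that] by blast
      then show "(\<lambda>t. fst (p t)) ` T \<subseteq> U" "(\<lambda>t. snd (p t)) ` T \<subseteq> U"
        by (simp_all add: image_subset_iff mem_Times_iff)
    qed
    have "\<delta> (fst ` p ` T) = \<delta> (snd ` p ` T)"
      using R p T(1) unfolding partial_iso_def by (meson finite_imageI image_subsetI)
    moreover have "\<bar>\<delta> ((\<lambda>t. fst (p t)) ` T) - \<delta> (fst ` T)\<bar> \<le> (\<Sum>t\<in>T. \<delta> {fst t, fst (p t)})"
      by (rule compatible_lipschitz_family[OF diversity_compatible[OF d] T(1) TU(1) pU(1)])
    moreover have "\<bar>\<delta> ((\<lambda>t. snd (p t)) ` T) - \<delta> (snd ` T)\<bar> \<le> (\<Sum>t\<in>T. \<delta> {snd t, snd (p t)})"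
      by (rule compatible_lipschitz_family[OF diversity_compatible[OF d] T(1) TU(2) pU(2)])
    moreover have "(\<Sum>t\<in>T. \<delta> {fst t, fst (p t)}) \<le> card T * \<eta>" "(\<Sum>t\<in>T. \<delta> {snd t, snd (p t)}) \<le> card T * \<eta>"
      by (rule sum_bounded_above, rule less_imp_le, use p in blast)+
    ultimately show ?thesis using \<eta>(2) by (simp add: image_image)
  qed
  then have "\<bar>\<delta> (fst ` T) - \<delta> (snd ` T)\<bar> \<le> 0" by (rule field_le_epsilon)
  then show "\<delta> (fst ` T) = \<delta> (snd ` T)" by simp
qed

text \<open>First coordinates of pairs in \<open>R\<close> that tend to \<open>u\<close> form a
  Cauchy sequence. \<open>R\<close> preserves distances, so the second coordinates are Cauchy too,
  and their limit is \<open>v\<close>.\<close>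

lemma rel_closure_total:
  assumes complete: "complete_div U \<delta>" and R: "partial_iso U \<delta> R" and dense: "dense_div (fst ` R) U \<delta>"
    and u: "u \<in> U"
  shows "\<exists>v\<in>U. (u, v) \<in> rel_closure U \<delta> R"
proof -
  have "\<exists>p. p \<in> R \<and> \<delta> {u, fst p} < inverse (real (Suc n))" for n
  proof -
    have "0 < inverse (real (Suc n))" by simp
    then show ?thesis using dense u unfolding dense_div_def by blast
  qed
  then obtain p where p: "\<And>n. p n \<in> R" "\<And>n. \<delta> {u, fst (p n)} < inverse (real (Suc n))" by metis
  have pU: "fst (p n) \<in> U" "snd (p n) \<in> U" for n
  proof -
    have "R \<subseteq> U \<times> U" using R by (simp add: partial_iso_def)
    then have "p n \<in> U \<times> U" using p(1) by blast
    then show "fst (p n) \<in> U" "snd (p n) \<in> U" by (simp_all add: mem_Times_iff)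
  qed
  have small: "\<exists>N. \<forall>n\<ge>N. \<delta> {u, fst (p n)} < e" if e: "0 < e" for e
  proof -
    obtain N where N: "inverse (real (Suc N)) < e" using reals_Archimedean[OF e] by blast
    have "\<delta> {u, fst (p n)} < e" if "N \<le> n" for n
    proof -
      have "inverse (real (Suc n)) \<le> inverse (real (Suc N))" using that by simp
      then show ?thesis using p(2)[of n] N by linarith
    qed
    then show ?thesis by blast
  qed
  have "\<exists>N. \<forall>m n. N \<le> m \<longrightarrow> N \<le> n \<longrightarrow> \<delta> {snd (p m), snd (p n)} < e" if e: "0 < e" for e
  proof -
    obtain N where N: "\<And>n. N \<le> n \<Longrightarrow> \<delta> {u, fst (p n)} < e / 2" using small[of "e / 2"] e by auto
    have "\<delta> {snd (p m), snd (p n)} < e" if "N \<le> m" "N \<le> n" for m n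
    proof -
      have "\<delta> (fst ` {p m, p n}) = \<delta> (snd ` {p m, p n})"
        using R p(1) unfolding partial_iso_def by (metis empty_subsetI finite.simps insert_subset)
      then have "\<delta> {snd (p m), snd (p n)} = \<delta> {fst (p m), fst (p n)}" by simp
      also have "\<dots> \<le> \<delta> {fst (p m), u} + \<delta> {u, fst (p n)}"
        by (rule diversity_triangle_pair[OF d pU(1) u pU(1)])
      also have "\<dots> < e" using N[OF that(1)] N[OF that(2)] by (simp add: insert_commute)
      finally show ?thesis .
    qed
    then show ?thesis by blast
  qed
  moreover have "range (\<lambda>n. snd (p n)) \<subseteq> U" using pU by auto
  ultimately obtain v where v: "v \<in> U" "\<And>e. 0 < e \<Longrightarrow> \<exists>N. \<forall>n\<ge>N. \<delta> {snd (p n), v} < e"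
    using complete unfolding complete_div_def by blast
  have "\<exists>(a, b)\<in>R. \<delta> {u, a} < e \<and> \<delta> {v, b} < e" if e: "0 < e" for e
  proof -
    obtain N M where N: "\<And>n. N \<le> n \<Longrightarrow> \<delta> {u, fst (p n)} < e" and M: "\<And>n. M \<le> n \<Longrightarrow> \<delta> {snd (p n), v} < e"
      using small[OF e] v(2)[OF e] by blast
    have "\<delta> {u, fst (p (max N M))} < e \<and> \<delta> {v, snd (p (max N M))} < e"
      using N M by (simp add: insert_commute)
    then show ?thesis using p(1)[of "max N M"] by (intro bexI[of _ "p (max N M)"]) (auto split: prod.split)
  qed
  then show ?thesis using u v(1) by (auto simp: rel_closure_def)
qed

lemma partial_iso_extends:
  assumes complete: "complete_div U \<delta>" and ext: "extension_property U \<delta>" and sep: "separable_div U \<delta>"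
    and R0: "partial_iso U \<delta> R0" "finite R0"
  shows "\<exists>\<psi>. diversity_iso U \<delta> U \<delta> \<psi> \<and> (\<forall>(a, b)\<in>R0. \<psi> a = b)"
proof -
  obtain D where D: "countable D" "D \<subseteq> U" "\<forall>x\<in>U. \<forall>e>0. \<exists>y\<in>D. \<delta> {x, y} < e"
    using sep unfolding separable_div_def by blast
  obtain R where R: "partial_iso U \<delta> R" "R0 \<subseteq> R" "D \<subseteq> fst ` R" "D \<subseteq> snd ` R"
  proof (cases "D = {}")
    \<comment> \<open>An empty \<open>D\<close> cannot be enumerated by
      \<open>from_nat_into\<close>, but then \<open>R0\<close> itself already covers it.\<close>
    case True
    then show ?thesis using that[of R0] R0 by simp
  next
    case False
    have "\<exists>R. partial_iso U \<delta> R \<and> R0 \<subseteq> R \<and> range (from_nat_into D) \<subseteq> fst ` R \<and> range (from_nat_into D) \<subseteq> snd ` R"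
      by (rule partial_iso_dense[OF ext R0]) (use from_nat_into[OF False] D(2) in blast)
    then show ?thesis using that range_from_nat_into[OF False D(1)] by auto
  qed
  have RU: "R \<subseteq> U \<times> U" using R(1) by (simp add: partial_iso_def)
  have dense: "dense_div (fst ` R) U \<delta>" "dense_div (fst ` (R\<inverse>)) U \<delta>"
    using D(3) R(3,4) RU unfolding dense_div_def fst_converse by (force, force)
  let ?G = "rel_closure U \<delta> R"
  have G: "partial_iso U \<delta> ?G" by (rule partial_iso_rel_closure[OF R(1)])
  define \<psi> where "\<psi> u = (SOME v. (u, v) \<in> ?G)" for u
  have \<psi>: "(u, \<psi> u) \<in> ?G" if "u \<in> U" for u
    using rel_closure_total[OF complete R(1) dense(1) that] unfolding \<psi>_def by (metis someI)
  have \<psi>_eq: "\<psi> u = v" if "(u, v) \<in> ?G" for u v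
  proof -
    have "u \<in> U" using that by (auto simp: rel_closure_def)
    from partial_iso_unique[OF G \<psi>[OF this] that] show ?thesis by simp
  qed
  have "bij_betw \<psi> U U"
  proof (rule bij_betwI')
    fix x y assume "x \<in> U" "y \<in> U"
    then show "(\<psi> x = \<psi> y) = (x = y)" using partial_iso_unique[OF G \<psi> \<psi>] by blast
  next
    fix x assume "x \<in> U"
    then show "\<psi> x \<in> U" using \<psi> by (force simp: rel_closure_def)
  next
    \<comment> \<open>Surjectivity is totality of the closure of the converse relation.\<close>
    fix y assume "y \<in> U"
    then obtain x where "x \<in> U" "(y, x) \<in> rel_closure U \<delta> (R\<inverse>)"
      using rel_closure_total[OF complete partial_iso_converse[OF R(1)] dense(2)] by blast
    then show "\<exists>x\<in>U. y = \<psi> x" using \<psi>_eq by (auto simp: rel_closure_converse)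
  qed
  moreover have "\<delta> (\<psi> ` A) = \<delta> A" if A: "A \<in> Fpow U" for A
  proof -
    let ?T = "(\<lambda>u. (u, \<psi> u)) ` A"
    have "finite ?T" "?T \<subseteq> ?G" using A \<psi> by (auto simp: Fpow_iff)
    then have "\<delta> (fst ` ?T) = \<delta> (snd ` ?T)" using G unfolding partial_iso_def by blast
    then show ?thesis by (simp add: image_image)
  qed
  moreover have "\<psi> a = b" if "(a, b) \<in> R0" for a b
    using \<psi>_eq subset_rel_closure[OF RU] R(2) that by blast
  ultimately show ?thesis unfolding diversity_iso_def by (intro exI[of _ \<psi>]) auto
qed

lemma ultrahomogeneousI:
  assumes "complete_div U \<delta>" "extension_property U \<delta>" "separable_div U \<delta>"
  shows "ultrahomogeneous U \<delta>"
  unfolding ultrahomogeneous_def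
proof (intro allI impI, elim conjE)
  fix A A' \<phi> assume A: "A \<in> Fpow U" "A' \<in> Fpow U" and iso: "diversity_iso A \<delta> A' \<delta> \<phi>"
  define R where "R = (\<lambda>a. (a, \<phi> a)) ` A"
  have img: "\<phi> ` A = A'" using iso by (simp add: diversity_iso_def bij_betw_def)
  have "partial_iso U \<delta> R"
    unfolding partial_iso_def
  proof (intro conjI allI impI)
    show "R \<subseteq> U \<times> U" using A img by (auto simp: R_def Fpow_iff)
    fix T assume "finite T" "T \<subseteq> R"
    then obtain B where B: "B \<subseteq> A" "T = (\<lambda>a. (a, \<phi> a)) ` B" by (auto simp: R_def subset_image_iff)
    then have "B \<in> Fpow A" using A(1) by (auto simp: Fpow_iff intro: finite_subset)
    then show "\<delta> (fst ` T) = \<delta> (snd ` T)" using iso B(2) by (simp add: diversity_iso_def image_image)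
  qed
  moreover have "finite R" using A by (simp add: R_def Fpow_iff)
  ultimately obtain \<psi> where "diversity_iso U \<delta> U \<delta> \<psi>" "\<forall>(a, b)\<in>R. \<psi> a = b"
    using partial_iso_extends[OF assms] by blast
  then show "\<exists>\<psi>. diversity_iso U \<delta> U \<delta> \<psi> \<and> (\<forall>a\<in>A. \<psi> a = \<phi> a)" by (auto simp: R_def)
qed

end

section \<open>Separability of the completion and the conclusion for a single starting point\<close>

lemma separable_div_dense:
  assumes d: "diversity U \<delta>" and dense: "dense_div Y U \<delta>" and sep: "separable_div Y \<delta>"
  shows "separable_div U \<delta>"
proof -
  obtain D where D: "countable D" "D \<subseteq> Y" "\<And>x e. x \<in> Y \<Longrightarrow> 0 < e \<Longrightarrow> \<exists>y\<in>D. \<delta> {x, y} < e"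
    using sep unfolding separable_div_def by blast
  have YU: "Y \<subseteq> U" using dense by (simp add: dense_div_def)
  have "\<exists>z\<in>D. \<delta> {x, z} < e" if x: "x \<in> U" and e: "0 < e" for x e
  proof -
    have "0 < e / 2" using e by simp
    then obtain y where y: "y \<in> Y" "\<delta> {x, y} < e / 2" using dense x unfolding dense_div_def by blast
    obtain z where z: "z \<in> D" "\<delta> {y, z} < e / 2" using D(3)[OF y(1) \<open>0 < e / 2\<close>] by blast
    have "\<delta> {x, z} \<le> \<delta> {x, y} + \<delta> {y, z}"
      by (rule diversity_triangle_pair[OF d x]) (use y z D(2) YU in auto)
    then show ?thesis using y z by (intro bexI[of _ z]) auto
  qed
  then show ?thesis unfolding separable_div_def using D YU by (intro exI[of _ D]) auto
qed

theorem theorem21: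
  fixes U :: "'u set" and \<delta>U :: "'u set \<Rightarrow> real"
  assumes "is_UU U \<delta>U"
  shows "ultrahomogeneous U \<delta>U"
proof -
  let ?X = "limit_carrier {()} (\<lambda>_. 0)" and ?\<delta> = "limit_div {()} (\<lambda>_. 0)"
  have point: "diversity {()} (\<lambda>_. 0)"
    by (rule diversityI) (auto simp: Fpow_iff subset_singleton_iff)
  have sep: "separable_div {()} (\<lambda>_. 0)"
    unfolding separable_div_def by (intro exI[of _ "{()}"]) auto
  obtain \<iota> where compl: "diversity_completion ?X ?\<delta> U \<delta>U \<iota>"
    using assms unfolding is_UU_def by blast
  have dX: "diversity ?X ?\<delta>" by (rule limit_diversity[OF point _ sep]) simp
  note iso = completion_iso[OF dX compl]
  note dU = completion_diversity[OF dX compl]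
  note dense = completion_dense[OF dX compl]
  note complete = completion_complete[OF dX compl]
  have "extension_property (\<iota> ` ?X) \<delta>U"
    by (rule extension_property_image[OF limit_extension[OF point _ sep] iso]) simp_all
  then have "extension_property U \<delta>U" by (rule completion_extension[OF dU dense _ complete])
  moreover have "separable_div (\<iota> ` ?X) \<delta>U"
    by (rule separable_div_image[OF limit_separable[OF point _ sep] iso]) simp_all
  then have "separable_div U \<delta>U" by (rule separable_div_dense[OF dU dense])
  ultimately show ?thesis by (rule ultrahomogeneousI[OF dU complete])
qed

end
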